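(* Let $\mathbb{F}_\theta^+$ be a 2-graph on a single vertex with graph C*-algebra $\mathcal{O}_\theta$ and distinguished state $\omega=\tau\Phi$. The *-algebra $\mathcal{O}_{\theta c}=\mathrm{span}\{s_us_v^*:u,v\in\mathbb{F}_\theta^+\}$ with the inner product $\langle A|B\rangle=\omega(A^*B)$ (and with involution $A\mapsto A^*$ and the complex one-parameter group $\triangle^z$, $z\in\mathbb{C}$) is a modular Hilbert algebra.
   Context: Let $\theta$ be a permutation of $\{1,\dots,m\}\times\{1,\dots,n\}$. The 2-graph on a single vertex $\mathbb{F}_\theta^+$ is the unital semigroup (identity $\varnothing$) generated by $e_1,\dots,e_m,f_1,\dots,f_n$, free in the $e_i$'s and free in the $f_j$'s, with the commutation relations $e_if_j=f_{j'}e_{i'}$ whenever $\theta(i,j)=(i',j')$. The degree of $w$ is $d(w)=(k,l)$, where $k$, $l$ are the numbers of $e$'s and $f$'s in $w$. $\mathcal{O}_\theta$ is the universal C*-algebra generated by isometries $\{s_u:u\in\mathbb{F}_\theta^+\}$ with $s_\varnothing=I$, $s_{uv}=s_us_v$, and $\sum_{i=1}^m s_{e_i}s_{e_i}^*=I=\sum_{j=1}^n s_{f_j}s_{f_j}^*$. The gauge automorphisms are $\gamma_{\mathbf t}(s_w)=t_1^kt_2^ls_w$ for $d(w)=(k,l)$, $\mathbf t=(t_1,t_2)\in\mathbb{T}^2$; $\Phi(X)=\int_{\mathbb{T}^2}\gamma_{\mathbf t}(X)\,d\mathbf t$ is the faithful conditional expectation onto the fixed point algebra $\mathfrak{F}=\overline{\bigcup_{k\ge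 1}\mathrm{span}\{s_us_v^*:d(u)=d(v)=(k,k)\}}$, an $(mn)^\infty$-UHF algebra. $\tau$ is the unique normalized trace on $\mathfrak{F}$ and $\omega=\tau\Phi$, a faithful state on $\mathcal{O}_\theta$. The inner product is linear in the second variable. For $z\in\mathbb{C}$, $\triangle^z$ is the linear map on $\mathcal{O}_{\theta c}$ with $\triangle^z(s_us_v^* )=m^{zk}n^{zl}s_us_v^*$, where $(k,l)=d(v)-d(u)$ and $m^z=\exp(z\ln m)$. (It is the complex power of the modular operator $\triangle=FS$, where $S(A)=A^*$ and $F$ is the anti-linear map on $\mathcal{O}_{\theta c}$ with $F(s_us_v^* )=m^{k}n^{l}s_vs_u^*$, $(k,l)=d(u)-d(v)$.) A modular Hilbert algebra (Tomita algebra) is a *-algebra $\mathfrak{A}$ (involution $a\mapsto a^\#$) with an inner product $\langle\cdot|\cdot\rangle$ (linear in the second variable) and a group of algebra automorphisms $\{\triangle(z)\}_{z\in\mathbb{C}}$, $\triangle(z+w)=\triangle(z)\triangle(w)$, such that for all $a,b,c\in\mathfrak{A}$, $z\in\mathbb{C}$: (1) $\langle ab|c\rangle=\langle b|a^\#c\rangle$; (2) $b\mapsto ab$ is bounded for each $a$; (3) the linear span of all products $ab$ is dense in $\mathfrak{A}$; (4) $(\triangle(z)a)^\#=\triangle(-\bar z)a^\#$; (5) $\langle\triangle(z)a|b\rangle=\langle a|\triangle(\bar z)b\rangle$; (6) $\langle\triangle(1)a^\#|b^\#\rangle=\langle b|a\rangle$; (7) $z\mapsto\langle a|\triangle(z)b\rangle$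 is entire; (8) for every $t\in\mathbb{R}$, $(1+\triangle(t))\mathfrak{A}$ is dense in $\mathfrak{A}$. *)

theory Defs
  imports "HOL-Analysis.Analysis" "HOL-Algebra.Ring"
begin

section \<open>Complex algebras and unital C*-algebras\<close>

class complex_algebra = ring +
  fixes scaleC :: "complex \<Rightarrow> 'a \<Rightarrow> 'a" (infixr "*\<^sub>C" 75)
  assumes scaleC_add_right: "c *\<^sub>C (x + y) = c *\<^sub>C x + c *\<^sub>C y"
    and scaleC_add_left: "(c + d) *\<^sub>C x = c *\<^sub>C x + d *\<^sub>C x"
    and scaleC_scaleC: "c *\<^sub>C d *\<^sub>C x = (c * d) *\<^sub>C x"
    and scaleC_one: "1 *\<^sub>C x = x"
    and mult_scaleC_left: "(c *\<^sub>C x) * y = c *\<^sub>C (x * y)"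
    and mult_scaleC_right: "x * (c *\<^sub>C y) = c *\<^sub>C (x * y)"

class cstar_algebra = complex_algebra + real_normed_algebra_1 + banach +
  fixes star :: "'a \<Rightarrow> 'a"
  assumes scaleR_scaleC: "r *\<^sub>R x = complex_of_real r *\<^sub>C x"
    and norm_scaleC: "norm (c *\<^sub>C x) = cmod c * norm x"
    and star_add: "star (x + y) = star x + star y"
    and star_scaleC: "star (c *\<^sub>C x) = cnj c *\<^sub>C star x"
    and star_mult: "star (x * y) = star y * star x"
    and star_star: "star (star x) = x"
    and cstar_identity: "norm (star x * x) = (norm x)\<^sup>2"

definition cspan :: "'a::complex_algebra set \<Rightarrow> 'a set"
  where "cspan = module.span scaleC"

definition clinear_on :: "'a::complex_algebra set \<Rightarrow> ('a \<Rightarrow> 'b::complex_algebra) \<Rightarrow> bool"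
  where "clinear_on V h \<longleftrightarrow>
    (\<forall>x\<in>V. \<forall>y\<in>V. h (x + y) = h x + h y) \<and> (\<forall>c. \<forall>x\<in>V. h (c *\<^sub>C x) = c *\<^sub>C h x)"

lemma vector_space_scaleC: "vector_space (scaleC :: complex \<Rightarrow> 'a::complex_algebra \<Rightarrow> 'a)"
  by unfold_locales (simp_all add: scaleC_add_right scaleC_add_left scaleC_scaleC scaleC_one)

instantiation complex :: cstar_algebra
begin

definition scaleC_complex :: "complex \<Rightarrow> complex \<Rightarrow> complex" where "scaleC_complex c x = c * x"
definition star_complex :: "complex \<Rightarrow> complex" where "star_complex = cnj"

instance
  by standard
    (simp_all add: scaleC_complex_def star_complex_def algebra_simps scaleR_conv_of_real
      norm_mult power2_eq_square)

end

text \<open>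
  The universal property of a C*-algebra quantifies over all unital C*-algebras, so inside a
  formula these have to be structures with an explicit carrier. The zero algebra is allowed here.
\<close>

record 'a cstar_struct = "'a ring" +
  cscale :: "complex \<Rightarrow> 'a \<Rightarrow> 'a"
  adj :: "'a \<Rightarrow> 'a"
  cnorm :: "'a \<Rightarrow> real"

locale cstar_structure = ring B for B (structure) +
  assumes cscale_closed: "x \<in> carrier B \<Longrightarrow> cscale B c x \<in> carrier B"
    and cscale_add_right: "\<lbrakk>x \<in> carrier B; y \<in> carrier B\<rbrakk> \<Longrightarrow>
      cscale B c (x \<oplus> y) = cscale B c x \<oplus> cscale B c y"
    and cscale_add_left: "x \<in> carrier B \<Longrightarrow> cscale B (c + d) x = cscale B c x \<oplus> cscale B d x"
    and cscale_cscale: "x \<in> carrier B \<Longrightarrow> cscale B c (cscale B d x) = cscale B (c * d) x"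
    and cscale_one: "x \<in> carrier B \<Longrightarrow> cscale B 1 x = x"
    and mult_cscale_left: "\<lbrakk>x \<in> carrier B; y \<in> carrier B\<rbrakk> \<Longrightarrow>
      cscale B c x \<otimes> y = cscale B c (x \<otimes> y)"
    and mult_cscale_right: "\<lbrakk>x \<in> carrier B; y \<in> carrier B\<rbrakk> \<Longrightarrow>
      x \<otimes> cscale B c y = cscale B c (x \<otimes> y)"
    and adj_closed: "x \<in> carrier B \<Longrightarrow> adj B x \<in> carrier B"
    and adj_add: "\<lbrakk>x \<in> carrier B; y \<in> carrier B\<rbrakk> \<Longrightarrow> adj B (x \<oplus> y) = adj B x \<oplus> adj B y"
    and adj_cscale: "x \<in> carrier B \<Longrightarrow> adj B (cscale B c x) = cscale B (cnj c) (adj B x)"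
    and adj_mult: "\<lbrakk>x \<in> carrier B; y \<in> carrier B\<rbrakk> \<Longrightarrow> adj B (x \<otimes> y) = adj B y \<otimes> adj B x"
    and adj_adj: "x \<in> carrier B \<Longrightarrow> adj B (adj B x) = x"
    and cnorm_eq_zero: "x \<in> carrier B \<Longrightarrow> cnorm B x = 0 \<longleftrightarrow> x = \<zero>"
    and cnorm_triangle: "\<lbrakk>x \<in> carrier B; y \<in> carrier B\<rbrakk> \<Longrightarrow>
      cnorm B (x \<oplus> y) \<le> cnorm B x + cnorm B y"
    and cnorm_cscale: "x \<in> carrier B \<Longrightarrow> cnorm B (cscale B c x) = cmod c * cnorm B x"
    and cnorm_mult: "\<lbrakk>x \<in> carrier B; y \<in> carrier B\<rbrakk> \<Longrightarrow>
      cnorm B (x \<otimes> y) \<le> cnorm B x * cnorm B y"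
    and cnorm_adj_mult: "x \<in> carrier B \<Longrightarrow> cnorm B (adj B x \<otimes> x) = (cnorm B x)\<^sup>2"
    and cnorm_complete:
      "\<lbrakk>\<And>k::nat. X k \<in> carrier B;
        \<forall>\<epsilon>>0. \<exists>N. \<forall>p\<ge>N. \<forall>q\<ge>N. cnorm B (X p \<ominus> X q) < \<epsilon>\<rbrakk> \<Longrightarrow>
        \<exists>x\<in>carrier B. (\<lambda>k. cnorm B (X k \<ominus> x)) \<longlonglongrightarrow> 0"

definition type_cstar :: "'a::cstar_algebra cstar_struct"
  where "type_cstar = \<lparr>carrier = UNIV, mult = (*), one = 1, zero = 0, add = (+),
    cscale = scaleC, adj = star, cnorm = norm\<rparr>"

definition star_hom :: "'a cstar_struct \<Rightarrow> 'b cstar_struct \<Rightarrow> ('a \<Rightarrow> 'b) \<Rightarrow> bool"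
  where "star_hom A B \<pi> \<longleftrightarrow> \<pi> \<in> ring_hom A B \<and>
    (\<forall>c. \<forall>x\<in>carrier A. \<pi> (cscale A c x) = cscale B c (\<pi> x)) \<and>
    (\<forall>x\<in>carrier A. \<pi> (adj A x) = adj B (\<pi> x))"

lemma cstar_structure_type_cstar: "cstar_structure (type_cstar :: 'a::cstar_algebra cstar_struct)"
proof -
  let ?B = "type_cstar :: 'a cstar_struct"
  have "abelian_group ?B"
  proof (rule abelian_groupI)
    fix x assume "x \<in> carrier ?B"
    show "\<exists>y\<in>carrier ?B. y \<oplus>\<^bsub>?B\<^esub> x = \<zero>\<^bsub>?B\<^esub>"
      by (rule bexI[of _ "- x"]) (simp_all add: type_cstar_def)
  qed (simp_all add: type_cstar_def algebra_simps)
  moreover have "Group.monoid ?B"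
    by (rule monoidI) (simp_all add: type_cstar_def algebra_simps)
  ultimately have r: "ring ?B"
    by (rule ringI) (simp_all add: type_cstar_def algebra_simps)
  interpret ring ?B by (rule r)
  have neg: "\<ominus>\<^bsub>?B\<^esub> y = - y" for y
    by (rule minus_equality) (simp_all add: type_cstar_def)
  have minus: "x \<ominus>\<^bsub>?B\<^esub> y = x - y" for x y
    unfolding a_minus_def neg by (simp add: type_cstar_def)
  have comp: "\<exists>x. (\<lambda>k. norm (X k - x)) \<longlonglongrightarrow> 0"
    if "\<forall>\<epsilon>>0. \<exists>N. \<forall>p\<ge>N. \<forall>q\<ge>N. norm (X p - X q) < \<epsilon>" for X :: "nat \<Rightarrow> 'a"
  proof -
    have "Cauchy X" using that by (simp add: Cauchy_def dist_norm)
    then obtain x where "X \<longlonglongrightarrow> x"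
      unfolding Cauchy_convergent_iff convergent_def by (elim exE)
    then show ?thesis
      by (intro exI[of _ x] tendsto_norm_zero LIM_zero)
  qed
  show ?thesis
  proof (unfold_locales, goal_cases)
    case (18 X)
    then show ?case using comp[of X] unfolding minus by (simp add: type_cstar_def)
  qed (simp_all add: type_cstar_def scaleC_add_right scaleC_add_left scaleC_scaleC scaleC_one
      mult_scaleC_left mult_scaleC_right star_add star_scaleC star_mult star_star
      norm_triangle_ineq norm_scaleC norm_mult_ineq cstar_identity)
qed

section \<open>The 2-graph on a single vertex\<close>

datatype gen = Egen nat | Fgen nat

definition words :: "nat \<Rightarrow> nat \<Rightarrow> gen list set"
  where "words m n = lists (Egen ` {1..m} \<union> Fgen ` {1..n})"

inductive word_cong :: "nat \<Rightarrow> nat \<Rightarrow> (nat \<times> nat \<Rightarrow> nat \<times> nat) \<Rightarrow> gen list \<Rightarrow> gen list \<Rightarrow> bool"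
  for m n \<theta>
  where
    comm: "\<lbrakk>i \<in> {1..m}; j \<in> {1..n}; \<theta> (i, j) = (i', j')\<rbrakk> \<Longrightarrow>
      word_cong m n \<theta> (u @ [Egen i, Fgen j] @ v) (u @ [Fgen j', Egen i'] @ v)"
  | refl: "word_cong m n \<theta> u u"
  | sym: "word_cong m n \<theta> u v \<Longrightarrow> word_cong m n \<theta> v u"
  | trans: "word_cong m n \<theta> u v \<Longrightarrow> word_cong m n \<theta> v w \<Longrightarrow> word_cong m n \<theta> u w"

definition word_rel :: "nat \<Rightarrow> nat \<Rightarrow> (nat \<times> nat \<Rightarrow> nat \<times> nat) \<Rightarrow> (gen list \<times> gen list) set"
  where "word_rel m n \<theta> = {(u, v). u \<in> words m n \<and> v \<in> words m n \<and> word_cong m n \<theta> u v}"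

text \<open>The semigroup presented by the generators and the commutation relations: elements are
  congruence classes of words.\<close>

definition two_graph :: "nat \<Rightarrow> nat \<Rightarrow> (nat \<times> nat \<Rightarrow> nat \<times> nat) \<Rightarrow> gen list set monoid"
  where "two_graph m n \<theta> =
    \<lparr>carrier = words m n // word_rel m n \<theta>,
     mult = (\<lambda>U V. \<Union>u\<in>U. \<Union>v\<in>V. word_rel m n \<theta> `` {u @ v}),
     one = word_rel m n \<theta> `` {[]}\<rparr>"

definition e_gen :: "nat \<Rightarrow> nat \<Rightarrow> (nat \<times> nat \<Rightarrow> nat \<times> nat) \<Rightarrow> nat \<Rightarrow> gen list set"
  where "e_gen m n \<theta> i = word_rel m n \<theta> `` {[Egen i]}"

definition f_gen :: "nat \<Rightarrow> nat \<Rightarrow> (nat \<times> nat \<Rightarrow> nat \<times> nat) \<Rightarrow> nat \<Rightarrow> gen list set"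
  where "f_gen m n \<theta> j = word_rel m n \<theta> `` {[Fgen j]}"

definition word_degree :: "gen list \<Rightarrow> nat \<times> nat"
  where "word_degree w =
    (length (filter (\<lambda>g. \<exists>i. g = Egen i) w), length (filter (\<lambda>g. \<exists>j. g = Fgen j) w))"

text \<open>The commutation relations preserve \<open>word_degree\<close>, so its image of a class is a singleton.\<close>

definition degree :: "gen list set \<Rightarrow> nat \<times> nat"
  where "degree U = the_elem (word_degree ` U)"

section \<open>The graph C*-algebra\<close>

definition graph_family ::
    "nat \<Rightarrow> nat \<Rightarrow> (nat \<times> nat \<Rightarrow> nat \<times> nat) \<Rightarrow> 'b cstar_struct \<Rightarrow> (gen list set \<Rightarrow> 'b) \<Rightarrow> bool"
  where "graph_family m n \<theta> B s \<longleftrightarrow>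
    (\<forall>u\<in>carrier (two_graph m n \<theta>). s u \<in> carrier B \<and> adj B (s u) \<otimes>\<^bsub>B\<^esub> s u = \<one>\<^bsub>B\<^esub>) \<and>
    s \<one>\<^bsub>two_graph m n \<theta>\<^esub> = \<one>\<^bsub>B\<^esub> \<and>
    (\<forall>u\<in>carrier (two_graph m n \<theta>). \<forall>v\<in>carrier (two_graph m n \<theta>).
      s (u \<otimes>\<^bsub>two_graph m n \<theta>\<^esub> v) = s u \<otimes>\<^bsub>B\<^esub> s v) \<and>
    (\<Oplus>\<^bsub>B\<^esub>i\<in>{1..m}. s (e_gen m n \<theta> i) \<otimes>\<^bsub>B\<^esub> adj B (s (e_gen m n \<theta> i))) = \<one>\<^bsub>B\<^esub> \<and>
    (\<Oplus>\<^bsub>B\<^esub>j\<in>{1..n}. s (f_gen m n \<theta> j) \<otimes>\<^bsub>B\<^esub> adj B (s (f_gen m n \<theta> j))) = \<one>\<^bsub>B\<^esub>"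

text \<open>
  The type \<open>'a\<close> is, via the family \<open>s\<close>, the universal C*-algebra of the 2-graph.
  It suffices to test universality against C*-algebras \<open>B\<close> whose carrier is a set of elements of
  \<open>'a\<close>: the C*-subalgebra generated by a countable family is separable, so it has at most
  continuum many elements, and \<open>'a\<close> has at least that many because it contains the
  scalar multiples of \<open>1\<close>.
\<close>

definition graph_cstar_algebra ::
    "nat \<Rightarrow> nat \<Rightarrow> (nat \<times> nat \<Rightarrow> nat \<times> nat) \<Rightarrow> (gen list set \<Rightarrow> 'a::cstar_algebra) \<Rightarrow> bool"
  where "graph_cstar_algebra m n \<theta> s \<longleftrightarrow>
    graph_family m n \<theta> type_cstar s \<and>
    (\<forall>S. closed S \<and> s ` carrier (two_graph m n \<theta>) \<subseteq> S \<and>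
        (\<forall>x\<in>S. \<forall>y\<in>S. x + y \<in> S \<and> x * y \<in> S) \<and> (\<forall>x\<in>S. star x \<in> S \<and> (\<forall>c. c *\<^sub>C x \<in> S))
      \<longrightarrow> S = UNIV) \<and>
    (\<forall>(B :: 'a cstar_struct) t. cstar_structure B \<and> graph_family m n \<theta> B t \<longrightarrow>
      (\<exists>!\<pi>. star_hom type_cstar B \<pi> \<and> (\<forall>w\<in>carrier (two_graph m n \<theta>). \<pi> (s w) = t w)))"

definition core_algebra ::
    "nat \<Rightarrow> nat \<Rightarrow> (nat \<times> nat \<Rightarrow> nat \<times> nat) \<Rightarrow> (gen list set \<Rightarrow> 'a::cstar_algebra) \<Rightarrow> 'a set"
  where "core_algebra m n \<theta> s =
    cspan {s u * star (s v) | u v. u \<in> carrier (two_graph m n \<theta>) \<and> v \<in> carrier (two_graph m n \<theta>)}"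

definition gauge ::
    "nat \<Rightarrow> nat \<Rightarrow> (nat \<times> nat \<Rightarrow> nat \<times> nat) \<Rightarrow> (gen list set \<Rightarrow> 'a::cstar_algebra) \<Rightarrow>
      complex \<times> complex \<Rightarrow> 'a \<Rightarrow> 'a"
  where "gauge m n \<theta> s t = (THE \<pi>. star_hom type_cstar type_cstar \<pi> \<and> bij \<pi> \<and>
    (\<forall>w\<in>carrier (two_graph m n \<theta>).
      \<pi> (s w) = (fst t ^ fst (degree w) * snd t ^ snd (degree w)) *\<^sub>C s w))"

text \<open>Integration over the torus with respect to normalised Haar measure, through the
  parametrisation \<open>(a, b) \<mapsto> (exp (2\<pi>\<i>a), exp (2\<pi>\<i>b))\<close> of the torus by the unit square.\<close>

definition gauge_expectation ::
    "nat \<Rightarrow> nat \<Rightarrow> (nat \<times> nat \<Rightarrow> nat \<times> nat) \<Rightarrow> (gen list set \<Rightarrow> 'a::cstar_algebra) \<Rightarrow> 'a \<Rightarrow> 'a"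
  where "gauge_expectation m n \<theta> s X =
    integral (cbox (0, 0) (1, 1))
      (\<lambda>p::real \<times> real. gauge m n \<theta> s (cis (2 * pi * fst p), cis (2 * pi * snd p)) X)"

definition fixed_algebra ::
    "nat \<Rightarrow> nat \<Rightarrow> (nat \<times> nat \<Rightarrow> nat \<times> nat) \<Rightarrow> (gen list set \<Rightarrow> 'a::cstar_algebra) \<Rightarrow> 'a set"
  where "fixed_algebra m n \<theta> s = closure (\<Union>k\<in>{1..}.
    cspan {s u * star (s v) | u v. u \<in> carrier (two_graph m n \<theta>) \<and> v \<in> carrier (two_graph m n \<theta>) \<and>
      degree u = (k, k) \<and> degree v = (k, k)})"

definition normalized_trace_on :: "'a::cstar_algebra set \<Rightarrow> ('a \<Rightarrow> complex) \<Rightarrow> bool"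
  where "normalized_trace_on A \<tau> \<longleftrightarrow> clinear_on A \<tau> \<and>
    (\<forall>x\<in>A. \<tau> (star x * x) \<in> \<real> \<and> 0 \<le> Re (\<tau> (star x * x))) \<and>
    (\<forall>x\<in>A. \<forall>y\<in>A. \<tau> (x * y) = \<tau> (y * x)) \<and> \<tau> 1 = 1"

text \<open>The normalised trace is unique on the fixed point algebra; the choice below only affects
  the irrelevant values of the HOL function outside that subalgebra.\<close>

definition fixed_trace ::
    "nat \<Rightarrow> nat \<Rightarrow> (nat \<times> nat \<Rightarrow> nat \<times> nat) \<Rightarrow> (gen list set \<Rightarrow> 'a::cstar_algebra) \<Rightarrow> 'a \<Rightarrow> complex"
  where "fixed_trace m n \<theta> s = (SOME \<tau>. normalized_trace_on (fixed_algebra m n \<theta> s) \<tau>)"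

definition distinguished_state ::
    "nat \<Rightarrow> nat \<Rightarrow> (nat \<times> nat \<Rightarrow> nat \<times> nat) \<Rightarrow> (gen list set \<Rightarrow> 'a::cstar_algebra) \<Rightarrow> 'a \<Rightarrow> complex"
  where "distinguished_state m n \<theta> s X = fixed_trace m n \<theta> s (gauge_expectation m n \<theta> s X)"

definition nat_cpow :: "nat \<Rightarrow> complex \<Rightarrow> complex"
  where "nat_cpow k z = exp (z * complex_of_real (ln (real k)))"

text \<open>The linear map on the span is determined by its values on the spanning elements; as for the
  trace, the choice only affects values outside its domain.\<close>

definition modular_power ::
    "nat \<Rightarrow> nat \<Rightarrow> (nat \<times> nat \<Rightarrow> nat \<times> nat) \<Rightarrow> (gen list set \<Rightarrow> 'a::cstar_algebra) \<Rightarrow>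
      complex \<Rightarrow> 'a \<Rightarrow> 'a"
  where "modular_power m n \<theta> s z = (SOME D. clinear_on (core_algebra m n \<theta> s) D \<and>
    (\<forall>u\<in>carrier (two_graph m n \<theta>). \<forall>v\<in>carrier (two_graph m n \<theta>).
      D (s u * star (s v)) =
        (nat_cpow m (z * of_int (int (fst (degree v)) - int (fst (degree u)))) *
         nat_cpow n (z * of_int (int (snd (degree v)) - int (snd (degree u))))) *\<^sub>C
        (s u * star (s v))))"

section \<open>Modular Hilbert algebras\<close>

locale complex_star_algebra =
  fixes A :: "'a::complex_algebra set" and sharp :: "'a \<Rightarrow> 'a"
  assumes zero_mem: "0 \<in> A"
    and add_mem: "\<lbrakk>a \<in> A; b \<in> A\<rbrakk> \<Longrightarrow> a + b \<in> A"
    and scaleC_mem: "a \<in> A \<Longrightarrow> c *\<^sub>C a \<in> A"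
    and mult_mem: "\<lbrakk>a \<in> A; b \<in> A\<rbrakk> \<Longrightarrow> a * b \<in> A"
    and sharp_mem: "a \<in> A \<Longrightarrow> sharp a \<in> A"
    and sharp_add: "\<lbrakk>a \<in> A; b \<in> A\<rbrakk> \<Longrightarrow> sharp (a + b) = sharp a + sharp b"
    and sharp_scaleC: "a \<in> A \<Longrightarrow> sharp (c *\<^sub>C a) = cnj c *\<^sub>C sharp a"
    and sharp_mult: "\<lbrakk>a \<in> A; b \<in> A\<rbrakk> \<Longrightarrow> sharp (a * b) = sharp b * sharp a"
    and sharp_sharp: "a \<in> A \<Longrightarrow> sharp (sharp a) = a"

locale complex_inner_product =
  fixes A :: "'a::complex_algebra set" and ip :: "'a \<Rightarrow> 'a \<Rightarrow> complex"
  assumes ip_linear_right: "a \<in> A \<Longrightarrow> clinear_on A (ip a)"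
    and ip_cnj: "\<lbrakk>a \<in> A; b \<in> A\<rbrakk> \<Longrightarrow> ip b a = cnj (ip a b)"
    and ip_nonneg: "a \<in> A \<Longrightarrow> 0 \<le> Re (ip a a)"
    and ip_definite: "\<lbrakk>a \<in> A; ip a a = 0\<rbrakk> \<Longrightarrow> a = 0"

definition ip_norm :: "('a \<Rightarrow> 'a \<Rightarrow> complex) \<Rightarrow> 'a \<Rightarrow> real"
  where "ip_norm ip a = sqrt (Re (ip a a))"

definition ip_dense :: "('a::complex_algebra \<Rightarrow> 'a \<Rightarrow> complex) \<Rightarrow> 'a set \<Rightarrow> 'a set \<Rightarrow> bool"
  where "ip_dense ip A D \<longleftrightarrow> D \<subseteq> A \<and> (\<forall>a\<in>A. \<forall>\<epsilon>>0. \<exists>d\<in>D. ip_norm ip (a - d) < \<epsilon>)"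

locale modular_hilbert_algebra =
  complex_star_algebra A sharp + complex_inner_product A ip
  for A :: "'a::complex_algebra set" and sharp :: "'a \<Rightarrow> 'a" and ip :: "'a \<Rightarrow> 'a \<Rightarrow> complex"
    and \<Delta> :: "complex \<Rightarrow> 'a \<Rightarrow> 'a" +
  assumes modular_bij: "bij_betw (\<Delta> z) A A"
    and modular_linear: "clinear_on A (\<Delta> z)"
    and modular_mult: "\<lbrakk>a \<in> A; b \<in> A\<rbrakk> \<Longrightarrow> \<Delta> z (a * b) = \<Delta> z a * \<Delta> z b"
    and modular_group: "a \<in> A \<Longrightarrow> \<Delta> (z + w) a = \<Delta> z (\<Delta> w a)"
    and ip_mult_left: "\<lbrakk>a \<in> A; b \<in> A; c \<in> A\<rbrakk> \<Longrightarrow> ip (a * b) c = ip b (sharp a * c)"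
    and left_mult_bounded: "a \<in> A \<Longrightarrow> \<exists>C. \<forall>b\<in>A. ip_norm ip (a * b) \<le> C * ip_norm ip b"
    and products_dense: "ip_dense ip A (cspan {a * b | a b. a \<in> A \<and> b \<in> A})"
    and modular_sharp: "a \<in> A \<Longrightarrow> sharp (\<Delta> z a) = \<Delta> (- cnj z) (sharp a)"
    and modular_symmetric: "\<lbrakk>a \<in> A; b \<in> A\<rbrakk> \<Longrightarrow> ip (\<Delta> z a) b = ip a (\<Delta> (cnj z) b)"
    and modular_one: "\<lbrakk>a \<in> A; b \<in> A\<rbrakk> \<Longrightarrow> ip (\<Delta> 1 (sharp a)) (sharp b) = ip b a"
    and modular_entire: "\<lbrakk>a \<in> A; b \<in> A\<rbrakk> \<Longrightarrow> (\<lambda>z. ip a (\<Delta> z b)) holomorphic_on UNIV"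
    and one_plus_modular_dense: "ip_dense ip A ((\<lambda>a. a + \<Delta> (complex_of_real t) a) ` A)"

end

theory Submission
  imports Defs
begin

text \<open>
  Since \<open>s\<^sub>u s\<^sub>v\<^sup>* = \<Sum>\<^sub>w s\<^sub>u\<^sub>w s\<^sub>v\<^sub>w\<^sup>*\<close>, where \<open>w\<close> runs over all elements of a fixed degree, every element of
  the core algebra is, for all large \<open>k\<close>, a combination of elements \<open>s\<^sub>u s\<^sub>v\<^sup>*\<close> with \<open>d(v) = (k, k)\<close>.
  These elements are eigenvectors of the modular group, and they are orthogonal, with
  squared norm \<open>(m n)\<^sup>-\<^sup>k\<close>, for the inner product of \<open>\<omega>\<close>, so that the axioms reduce to identities
  between basis elements. Left multiplication is bounded because \<open>s\<^sub>u\<close> acts isometrically and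
  \<open>\<Sum>\<^sub>v \<parallel>s\<^sub>v\<^sup>* b\<parallel>\<^sup>2 = \<parallel>b\<parallel>\<^sup>2\<close>. The orthogonality of the ranges of the generating isometries follows from
  the fact that the unit is an extreme point of the unit ball, which the C*-identity gives without
  any spectral theory. The map with eigenvalues \<open>m\<^sup>z\<^sup>k n\<^sup>z\<^sup>l\<close> is well defined because the Fourier
  coefficients of the gauge action split the core algebra into its homogeneous components.
\<close>

section \<open>Isometries in C*-algebras\<close>

text \<open>The trace and the modular power are picked by \<open>SOME\<close>, so objects with the
  required properties must first be exhibited: limits of averages for the trace, finite weighted
  sums of homogeneous components for the modular power. For the trace one must also see that every
  normalised trace has the same values on the spanning elements. The gauge automorphisms, given by
  \<open>THE\<close>, need existence and uniqueness; both come from the universal property tested on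
  the algebra itself.

  The semigroup enters only through the finite set of isometries of each degree. The commutation
  relations show that a word of suitable degree can be made to begin with an e or with an f. That
  different factorisations give different isometries is read off from the orthogonality of ranges,
  and so is the number of isometries of degree (k, l), which is m^k n^l. Its reciprocal normalises
  the state, and the quotient of two such numbers is the modular weight at 1, so the axiom relating
  the involution to the modular operator becomes a comparison of cardinalities.\<close>

interpretation cvs: vector_space "scaleC :: complex \<Rightarrow> 'a \<Rightarrow> 'a::complex_algebra"
  by (rule vector_space_scaleC)

lemma cspan_eq: "cspan = cvs.span"
  by (simp add: cspan_def)

lemma cspan_base: "x \<in> B \<Longrightarrow> x \<in> cspan B"
  by (simp add: cspan_eq cvs.span_base)

lemma cspan_zero [simp]: "0 \<in> cspan B"
  by (simp add: cspan_eq cvs.span_zero)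

lemma cspan_add: "\<lbrakk>x \<in> cspan B; y \<in> cspan B\<rbrakk> \<Longrightarrow> x + y \<in> cspan B"
  by (simp add: cspan_eq cvs.span_add)

lemma cspan_diff: "\<lbrakk>x \<in> cspan B; y \<in> cspan B\<rbrakk> \<Longrightarrow> x - y \<in> cspan B"
  by (simp add: cspan_eq cvs.span_diff)

lemma cspan_scaleC: "x \<in> cspan B \<Longrightarrow> c *\<^sub>C x \<in> cspan B"
  by (simp add: cspan_eq cvs.span_scale)

lemma cspan_sum: "(\<And>i. i \<in> I \<Longrightarrow> f i \<in> cspan B) \<Longrightarrow> sum f I \<in> cspan B"
  by (simp add: cspan_eq cvs.span_sum)

lemma cspan_mono: "A \<subseteq> B \<Longrightarrow> cspan A \<subseteq> cspan B"
  by (simp add: cspan_eq cvs.span_mono)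

lemma cspan_minimal:
  assumes "\<And>x. x \<in> B \<Longrightarrow> x \<in> cspan C"
  shows "cspan B \<subseteq> cspan C"
  unfolding cspan_eq by (rule cvs.span_minimal) (use assms in \<open>auto simp: cspan_eq cvs.subspace_span\<close>)

text \<open>Scalars are absorbed into the base case, so a property need not be shown stable under
  scaling of arbitrary elements of the span.\<close>

lemma cspan_induct [consumes 1, case_names zero add base]:
  assumes "a \<in> cspan B" and "P 0"
    and "\<And>x y. \<lbrakk>x \<in> cspan B; P x; y \<in> cspan B; P y\<rbrakk> \<Longrightarrow> P (x + y)"
    and "\<And>c x. x \<in> B \<Longrightarrow> P (c *\<^sub>C x)"
  shows "P a"
proof -
  have "a \<in> cspan B \<and> P a"
    using assms(1) unfolding cspan_eq
  proof (induction rule: cvs.span_induct_alt)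
    case base
    then show ?case using assms(2) by (simp add: cvs.span_zero)
  next
    case (step c x y)
    have "c *\<^sub>C x \<in> cvs.span B" using step by (intro cvs.span_scale cvs.span_base)
    then show ?case using step assms(3)[of "c *\<^sub>C x" y] assms(4)[of x c]
      by (simp add: cvs.span_add cspan_eq)
  qed
  then show ?thesis by simp
qed

lemma clinear_onD:
  assumes "clinear_on V h"
  shows "\<lbrakk>x \<in> V; y \<in> V\<rbrakk> \<Longrightarrow> h (x + y) = h x + h y" and "x \<in> V \<Longrightarrow> h (c *\<^sub>C x) = c *\<^sub>C h x"
  using assms by (auto simp: clinear_on_def)

lemma clinear_on_0:
  assumes "clinear_on V h" and "0 \<in> V"
  shows "h 0 = 0"
  using clinear_onD(2)[OF assms, of 0] by simp

lemma clinear_on_sum: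
  assumes "clinear_on V h" and "0 \<in> V" and "\<And>x y. \<lbrakk>x \<in> V; y \<in> V\<rbrakk> \<Longrightarrow> x + y \<in> V"
    and "\<And>i. i \<in> I \<Longrightarrow> f i \<in> V"
  shows "h (\<Sum>i\<in>I. f i) = (\<Sum>i\<in>I. h (f i))"
proof -
  have "sum f I \<in> V \<and> h (\<Sum>i\<in>I. f i) = (\<Sum>i\<in>I. h (f i))"
    using assms(4)
  proof (induction I rule: infinite_finite_induct)
    case (insert i I)
    then show ?case using assms(3) clinear_onD(1)[OF assms(1)] by auto
  qed (use clinear_on_0[OF assms(1,2)] assms(2) in auto)
  then show ?thesis by simp
qed

lemma clinear_on_eqI:
  assumes f: "clinear_on V f" and g: "clinear_on V g"
    and "cspan B \<subseteq> V" and "\<And>x. x \<in> B \<Longrightarrow> f x = g x" and "a \<in> cspan B"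
  shows "f a = g a"
proof -
  have "0 \<in> V" "B \<subseteq> V" using assms(3) cspan_zero cspan_base by blast+
  from assms(5) show ?thesis
  proof (induction rule: cspan_induct)
    case zero
    show ?case using clinear_on_0[OF f \<open>0 \<in> V\<close>] clinear_on_0[OF g \<open>0 \<in> V\<close>] by simp
  next
    case (add x y)
    then have "x \<in> V" "y \<in> V" using assms(3) by auto
    then show ?case using add clinear_onD(1)[OF f, of x y] clinear_onD(1)[OF g, of x y] by simp
  next
    case (base c x)
    then have "x \<in> V" using \<open>B \<subseteq> V\<close> by blast
    then show ?case using assms(4)[OF base] by (simp add: clinear_onD(2)[OF f] clinear_onD(2)[OF g])
  qed
qed

lemma scaleC_sum_right: "c *\<^sub>C (\<Sum>i\<in>I. f i) = (\<Sum>i\<in>I. c *\<^sub>C f i)"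
  by (rule cvs.scale_sum_right)

lemma star_0 [simp]: "star 0 = (0::'a::cstar_algebra)"
  using star_add[of 0 "0::'a"] by simp

lemma star_1 [simp]: "star 1 = (1::'a::cstar_algebra)"
  using star_mult[of "star 1" "1::'a"] by (simp add: star_star)

lemma star_minus: "star (- x) = - star (x::'a::cstar_algebra)"
  using star_add[of x "- x"] by (simp add: eq_neg_iff_add_eq_0 add.commute)

lemma star_diff: "star (x - y) = star x - star (y::'a::cstar_algebra)"
  using star_add[of x "- y"] by (simp add: star_minus)

lemma star_sum: "star (\<Sum>i\<in>I. f i) = (\<Sum>i\<in>I. star (f i :: 'a::cstar_algebra))"
  by (induction I rule: infinite_finite_induct) (simp_all add: star_add)

lemma norm_star [simp]: "norm (star x) = norm (x::'a::cstar_algebra)"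
proof -
  have le: "norm y \<le> norm (star y)" for y :: 'a
  proof (cases "y = 0")
    case False
    have "norm y * norm y \<le> norm (star y) * norm y"
      using norm_mult_ineq[of "star y" y] by (simp add: cstar_identity power2_eq_square)
    then show ?thesis using False by simp
  qed simp
  show ?thesis using le[of x] le[of "star x"] by (simp add: star_star)
qed

lemma star_mult_self_eq_0_iff: "star x * x = 0 \<longleftrightarrow> x = (0::'a::cstar_algebra)"
  using cstar_identity[of x] by (metis mult_zero_right norm_eq_zero power_zero_numeral zero_eq_power2)

lemma norm_isometry: "star x * x = 1 \<Longrightarrow> norm (x::'a::cstar_algebra) = 1"
  using cstar_identity[of x] by (metis norm_ge_zero norm_one power2_eq_1_iff  one_neq_neg_one order_le_less zero_less_one not_one_le_zero neg_0_le_iff_le)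

lemma norm_projection_le:
  fixes p :: "'a::cstar_algebra"
  assumes "star p = p" "p * p = p"
  shows "norm p \<le> 1"
proof -
  have "norm p * norm p = norm p" using cstar_identity[of p] assms by (simp add: power2_eq_square)
  then show ?thesis by auto
qed

section \<open>The unit as an extreme point, and orthogonality of ranges\<close>

lemma norm_midpoint_le:
  fixes x y :: "'a::cstar_algebra"
  assumes "norm x \<le> 1" "norm y \<le> 1" "x + y = 2 *\<^sub>C z"
  shows "norm z \<le> 1"
proof -
  have "2 * norm z = norm (x + y)" by (simp add: assms(3) norm_scaleC)
  also have "\<dots> \<le> 2" using norm_triangle_ineq[of x y] assms by simp
  finally show ?thesis by simp
qed

lemma norm_square_le: "norm x \<le> 1 \<Longrightarrow> norm (x * x) \<le> 1" for x :: "'a::real_normed_algebra"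
  by (meson mult_le_one norm_ge_zero norm_mult_ineq order_trans)

text \<open>The disc of those \<open>z\<close> with \<open>\<parallel>1 + z a\<parallel> \<le> 1\<close> grows: averaging squares with cancelling
  quadratic terms shows that it contains \<open>1 \<plusminus> \<i>\<close> and then \<open>2\<close>, as soon as it contains \<open>\<plusminus>1\<close>
  and \<open>\<plusminus>\<i>\<close>.\<close>

lemma norm_one_plus_double:
  fixes a :: "'a::cstar_algebra"
  assumes a: "star a = a" and p: "norm (1 + a) \<le> 1" and q: "norm (1 - a) \<le> 1"
  shows "norm (1 + 2 *\<^sub>C a) \<le> 1"
proof -
  have two: "2 *\<^sub>C x = x + x" for x :: 'a
    by (metis one_add_one scaleC_add_left scaleC_one)
  have sq: "norm (1 + a * a) \<le> 1"
  proof (rule norm_midpoint_le)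
    show "(1 + a) * (1 + a) + (1 - a) * (1 - a) = 2 *\<^sub>C (1 + a * a)"
      by (simp add: two algebra_simps)
  qed (use p q norm_square_le in auto)
  \<comment> \<open>Here z is i or -i. The C*-identity then turns the squared norm of
    \<open>1 + z a\<close> into the norm of \<open>1 + a * a\<close>, which \<open>sq\<close>
    bounds.\<close>
  have ii: "norm (1 + z *\<^sub>C a) \<le> 1" if "cnj z = - z" "z * z = - 1" for z
  proof -
    have "star (1 + z *\<^sub>C a) * (1 + z *\<^sub>C a) = (1 - z *\<^sub>C a) * (1 + z *\<^sub>C a)"
      using that by (simp add: star_add star_scaleC a)
    also have "\<dots> = 1 + a * a"
      using that by (simp add: algebra_simps mult_scaleC_left mult_scaleC_right scaleC_scaleC scaleC_one)
    finally have "(norm (1 + z *\<^sub>C a))\<^sup>2 \<le> 1\<^sup>2" using sq cstar_identity[of "1 + z *\<^sub>C a"] by simp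
    then show ?thesis by (rule power2_le_imp_le) simp
  qed
  have step: "norm (1 + w *\<^sub>C a) \<le> 1"
    if "norm (1 + z1 *\<^sub>C a) \<le> 1" "norm (1 + z2 *\<^sub>C a) \<le> 1" "z1 * z1 + z2 * z2 = 0" "z1 + z2 = w"
    for z1 z2 w
  proof (rule norm_midpoint_le)
    have "(z1 * z1) *\<^sub>C (a * a) + (z2 * z2) *\<^sub>C (a * a) = 0"
      by (simp add: scaleC_add_left[symmetric] that(3))
    moreover have "(1 + z *\<^sub>C a) * (1 + z *\<^sub>C a) = 1 + 2 *\<^sub>C (z *\<^sub>C a) + (z * z) *\<^sub>C (a * a)" for z
    proof -
      have "(z *\<^sub>C a) * (z *\<^sub>C a) = (z * z) *\<^sub>C (a * a)"
        by (simp add: mult_scaleC_left mult_scaleC_right scaleC_scaleC)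
      then show ?thesis by (simp add: two[of "z *\<^sub>C a"] distrib_left distrib_right add.assoc
          del: cvs.scale_scale)
    qed
    ultimately show "(1 + z1 *\<^sub>C a) * (1 + z1 *\<^sub>C a) + (1 + z2 *\<^sub>C a) * (1 + z2 *\<^sub>C a) = 2 *\<^sub>C (1 + w *\<^sub>C a)"
      by (simp add: that(4)[symmetric] two[of 1] scaleC_add_right scaleC_add_left algebra_simps)
  qed (use that norm_square_le in auto)
  have i1: "norm (1 + (1 + \<i>) *\<^sub>C a) \<le> 1"
    by (rule step[of 1 \<i>]) (use p ii[of \<i>] in \<open>auto simp: scaleC_one\<close>)
  have i2: "norm (1 + (1 - \<i>) *\<^sub>C a) \<le> 1"
    by (rule step[of 1 "- \<i>"]) (use p ii[of "- \<i>"] in \<open>auto simp: scaleC_one\<close>)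
  show ?thesis
    by (rule step[OF i1 i2]) (simp_all add: algebra_simps)
qed

text \<open>By \<open>norm_one_plus_double\<close> for a and for -a, the hypotheses survive the
  replacement of a by 2a. Hence every 2^k a has norm at most 2, which forces a = 0.\<close>

lemma one_extreme:
  fixes a :: "'a::cstar_algebra"
  assumes a: "star a = a" and p: "norm (1 + a) \<le> 1" and q: "norm (1 - a) \<le> 1"
  shows "a = 0"
proof (rule ccontr)
  assume "a \<noteq> 0"
  have k: "norm (1 + (2 ^ k) *\<^sub>C a) \<le> 1 \<and> norm (1 - (2 ^ k) *\<^sub>C a) \<le> 1" for k :: nat
  proof (induction k)
    case 0
    then show ?case using p q by (simp add: scaleC_one)
  next
    case (Suc k)
    have "star ((2 ^ k) *\<^sub>C a) = (2 ^ k) *\<^sub>C a" by (simp add: star_scaleC a)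
    then show ?case
      using Suc norm_one_plus_double[of "(2 ^ k) *\<^sub>C a"] norm_one_plus_double[of "- ((2 ^ k) *\<^sub>C a)"]
      by (simp add: scaleC_scaleC star_minus cvs.scale_minus_right)
  qed
  have le: "2 ^ k * norm a \<le> 2" for k
  proof -
    have "norm ((2 ^ k) *\<^sub>C a) \<le> norm (1 + (2 ^ k) *\<^sub>C a) + norm (1 :: 'a)"
      using norm_triangle_ineq4[of "1 + (2 ^ k) *\<^sub>C a" 1] by simp
    then show ?thesis using k[of k] by (simp add: norm_scaleC norm_power)
  qed
  obtain k where "2 / norm a < 2 ^ k" using real_arch_pow[of 2] by auto
  then have "2 < 2 ^ k * norm a" using \<open>a \<noteq> 0\<close> by (simp add: field_simps)
  then show False using le[of k] by simp
qed

text \<open>With N indices other than k, \<open>1 + z k / N\<close> is the mean of the elements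
  \<open>1 - z i\<close> over those i, and \<open>1 - z k / N\<close> is a convex combination of
  \<open>1\<close> and \<open>1 - z k\<close>. Both lie in the unit ball, so
  \<open>one_extreme\<close> applies to \<open>z k / N\<close>. This plays the part of the fact that
  positive elements with sum 0 vanish. A single index is treated apart because N would be 0.\<close>

lemma sum_near_one_eq_0:
  fixes z :: "'b \<Rightarrow> 'a::cstar_algebra"
  assumes fin: "finite I" and "\<And>i. i \<in> I \<Longrightarrow> star (z i) = z i"
    and le: "\<And>i. i \<in> I \<Longrightarrow> norm (1 - z i) \<le> 1" and "(\<Sum>i\<in>I. z i) = 0" and k: "k \<in> I"
  shows "z k = 0"
proof (cases "I = {k}")
  case True
  then show ?thesis using assms(4) by simp
next
  case False
  define N where "N = card (I - {k})"
  have N: "N \<ge> 1"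
    using False fin k unfolding N_def by (metis One_nat_def Suc_leI card_gt_0_iff finite_Diff Diff_eq_empty_iff subset_singletonD empty_iff)
  let ?r = "1 / real N"
  have zk: "z k = - (\<Sum>i\<in>I - {k}. z i)"
    using assms(4) fin k by (simp add: sum.remove eq_neg_iff_add_eq_0)
  have "norm (real N *\<^sub>R 1 + z k) = norm (\<Sum>i\<in>I - {k}. 1 - z i)"
    by (simp add: zk sum_subtractf N_def scaleR_conv_of_real)
  also have "\<dots> \<le> (\<Sum>i\<in>I - {k}. 1)"
    by (rule order_trans[OF norm_sum], rule sum_mono) (use le in auto)
  finally have "norm (real N *\<^sub>R 1 + z k) \<le> real N" by (simp add: N_def)
  moreover have "real N *\<^sub>R 1 + z k = real N *\<^sub>R (1 + ?r *\<^sub>R z k)"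
    using N by (simp add: scaleR_add_right)
  ultimately have p: "norm (1 + ?r *\<^sub>R z k) \<le> 1"
    using N by simp
  have "1 - ?r *\<^sub>R z k = (1 - ?r) *\<^sub>R 1 + ?r *\<^sub>R (1 - z k)"
    by (simp add: algebra_simps)
  then have "norm (1 - ?r *\<^sub>R z k) \<le> \<bar>1 - ?r\<bar> * norm (1::'a) + \<bar>?r\<bar> * norm (1 - z k)"
    by (metis norm_scaleR norm_triangle_ineq)
  also have "\<dots> \<le> (1 - ?r) + ?r * 1"
    using N le[OF k] by (intro add_mono) (auto intro!: divide_right_mono)
  finally have q: "norm (1 - ?r *\<^sub>R z k) \<le> 1" by simp
  have "star (?r *\<^sub>R z k) = ?r *\<^sub>R z k" by (simp add: scaleR_scaleC star_scaleC assms(2)[OF k])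
  from one_extreme[OF this p q] N show ?thesis by simp
qed

text \<open>The range projections are compressed by \<open>e j\<close>. The compressions
  \<open>z k\<close> add up to \<open>1\<close> and \<open>z j = 1\<close>, so the others add up to
  0. Each \<open>1 - z k\<close> is the compression of a projection, hence a contraction, and
  \<open>z i\<close> is the square modulus of \<open>star (e i) * e j\<close>.\<close>

lemma isometries_orthogonal:
  fixes e :: "'b \<Rightarrow> 'a::cstar_algebra"
  assumes fin: "finite I" and iso: "\<And>i. i \<in> I \<Longrightarrow> star (e i) * e i = 1"
    and sum: "(\<Sum>i\<in>I. e i * star (e i)) = 1" and i: "i \<in> I" and j: "j \<in> I" and "i \<noteq> j"
  shows "star (e i) * e j = 0"
proof -
  define z where "z k = star (e j) * (e k * star (e k)) * e j" for k
  have "(\<Sum>k\<in>I. z k) = star (e j) * (\<Sum>k\<in>I. e k * star (e k)) * e j"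
    by (simp add: z_def sum_distrib_left sum_distrib_right)
  also have "\<dots> = 1" using sum iso[OF j] by simp
  finally have "(\<Sum>k\<in>I. z k) = 1" .
  moreover have "z j = (star (e j) * e j) * (star (e j) * e j)" by (simp add: z_def mult.assoc)
  then have "z j = 1" by (simp add: iso[OF j])
  ultimately have 0: "(\<Sum>k\<in>I - {j}. z k) = 0" using fin j by (simp add: sum.remove)
  have "z i = 0"
  proof (rule sum_near_one_eq_0[OF _ _ _ 0])
    fix k assume "k \<in> I - {j}"
    then have k: "star (e k) * e k = 1" using iso by simp
    show "star (z k) = z k" by (simp add: z_def star_mult star_star mult.assoc)
    define p where "p = 1 - e k * star (e k)"
    have kk: "e k * star (e k) * (e k * star (e k)) = e k * star (e k)"
      using k by (metis mult.assoc mult_1_right)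
    have "norm p \<le> 1"
      by (rule norm_projection_le) (simp_all add: p_def star_diff star_mult star_star algebra_simps kk[unfolded mult.assoc])
    moreover have "1 - z k = star (e j) * p * e j"
      by (simp add: z_def p_def algebra_simps iso[OF j])
    ultimately show "norm (1 - z k) \<le> 1"
      using norm_mult_ineq[of "star (e j) * p" "e j"] norm_mult_ineq[of "star (e j)" p]
        norm_isometry[OF iso[OF j]] by simp
  qed (use fin i \<open>i \<noteq> j\<close> in auto)
  moreover have "z i = star (star (e i) * e j) * (star (e i) * e j)"
    by (simp add: z_def star_mult star_star mult.assoc)
  ultimately show ?thesis by (simp add: star_mult_self_eq_0_iff)
qed

section \<open>Complete orthogonal sets of isometries\<close>

text \<open>The isometries of a Cuntz family, kept as a set and not as an indexed family, so that
  two words giving the same isometry cause no trouble and counting is plain cardinality.\<close>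

definition frame :: "'a::cstar_algebra set \<Rightarrow> bool"
  where "frame V \<longleftrightarrow> finite V \<and> (\<forall>x\<in>V. \<forall>y\<in>V. star x * y = (if x = y then 1 else 0)) \<and>
    (\<Sum>x\<in>V. x * star x) = 1"

lemma frame_finite: "frame V \<Longrightarrow> finite V"
  and frame_star_mult: "\<lbrakk>frame V; x \<in> V; y \<in> V\<rbrakk> \<Longrightarrow> star x * y = (if x = y then 1 else 0)"
  and frame_sum: "frame V \<Longrightarrow> (\<Sum>x\<in>V. x * star x) = 1"
  by (auto simp: frame_def)

lemma frame_one: "frame {1 :: 'a::cstar_algebra}"
  by (simp add: frame_def)

lemma frame_isometries:
  fixes e :: "'b \<Rightarrow> 'a::cstar_algebra"
  assumes "finite I" and iso: "\<And>i. i \<in> I \<Longrightarrow> star (e i) * e i = 1"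
    and "(\<Sum>i\<in>I. e i * star (e i)) = 1"
  shows "inj_on e I" and "frame (e ` I)"
proof -
  note orth = isometries_orthogonal[OF assms]
  show inj: "inj_on e I"
  proof (rule inj_onI, rule ccontr)
    fix i j assume "i \<in> I" "j \<in> I" "e i = e j" "i \<noteq> j"
    then show False using orth[of i j] iso[of j] by simp
  qed
  show "frame (e ` I)"
    using assms inj orth by (auto simp: frame_def sum.reindex)
qed

text \<open>Orthonormality makes the product map injective on pairs: if two different pairs had the
  same product, the inner product of that element with itself would be both 0 and 1. This is where
  unique factorisation comes from.\<close>

lemma frame_mult:
  fixes U V :: "'a::cstar_algebra set"
  assumes U: "frame U" and V: "frame V"
  shows "frame {x * y |x y. x \<in> U \<and> y \<in> V}" and "card {x * y |x y. x \<in> U \<and> y \<in> V} = card U * card V"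
proof -
  have eq: "{x * y |x y. x \<in> U \<and> y \<in> V} = (\<lambda>(x, y). x * y) ` (U \<times> V)" by auto
  have st: "star (x * y) * (x' * y') = (if (x, y) = (x', y') then 1 else 0)"
    if "x \<in> U" "y \<in> V" "x' \<in> U" "y' \<in> V" for x y x' y'
  proof -
    have "star (x * y) * (x' * y') = star y * (star x * x') * y'"
      by (simp add: star_mult mult.assoc)
    then show ?thesis
      using frame_star_mult[OF U, of x x'] frame_star_mult[OF V, of y y'] frame_star_mult[OF V, of y' y'] that by simp
  qed
  have inj: "inj_on (\<lambda>(x, y). x * y) (U \<times> V)"
  proof (rule inj_onI, rule ccontr)
    fix p q assume pq: "p \<in> U \<times> V" "q \<in> U \<times> V" "(\<lambda>(x, y). x * y) p = (\<lambda>(x, y). x * y) q" "p \<noteq> q"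
    show False
      using st[of "fst p" "snd p" "fst q" "snd q"] st[of "fst q" "snd q" "fst q" "snd q"] pq
      by (auto simp: split_beta prod_eq_iff)
  qed
  show "card {x * y |x y. x \<in> U \<and> y \<in> V} = card U * card V"
    unfolding eq by (simp add: card_image[OF inj] card_cartesian_product)
  have "(\<Sum>z\<in>(\<lambda>(x, y). x * y) ` (U \<times> V). z * star z) = (\<Sum>(x, y)\<in>U \<times> V. x * y * star (x * y))"
    by (subst sum.reindex[OF inj]) (simp add: split_beta comp_def)
  also have "\<dots> = (\<Sum>x\<in>U. \<Sum>y\<in>V. x * (y * star y) * star x)"
    by (simp add: sum.cartesian_product star_mult mult.assoc)
  also have "\<dots> = 1"
    by (simp add: sum_distrib_left[symmetric] sum_distrib_right[symmetric] frame_sum[OF V] frame_sum[OF U])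
  finally show "frame {x * y |x y. x \<in> U \<and> y \<in> V}"
    using frame_finite[OF U] frame_finite[OF V] inj st unfolding eq frame_def
    by (auto simp: inj_on_def)
qed

text \<open>Pythagoras: q is the sum of the squared moduli of the coefficients times r, so
  positivity and definiteness come out together. It serves the state on a \<open>block\<close> and
  the trace on matrix units; V is the part of the algebra on which the form is known to be
  linear.\<close>

lemma clinear_form_orthogonal_basis:
  fixes h :: "'a::cstar_algebra \<Rightarrow> complex"
  assumes h: "clinear_on V h" and V0: "0 \<in> V" and V1: "\<And>x y. \<lbrakk>x \<in> V; y \<in> V\<rbrakk> \<Longrightarrow> x + y \<in> V"
    and V2: "\<And>c x. x \<in> V \<Longrightarrow> c *\<^sub>C x \<in> V"
    and B: "\<And>x y. \<lbrakk>x \<in> B; y \<in> B\<rbrakk> \<Longrightarrow> star x * y \<in> V"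
    and orth: "\<And>x y. \<lbrakk>x \<in> B; y \<in> B\<rbrakk> \<Longrightarrow> h (star x * y) = (if x = y then complex_of_real r else 0)"
    and r: "r > 0" and a: "a \<in> cspan B"
  shows "\<exists>q\<ge>0. h (star a * a) = complex_of_real q \<and> (q = 0 \<longrightarrow> a = 0)"
proof -
  obtain T c where T: "finite T" "T \<subseteq> B" and a_eq: "a = (\<Sum>x\<in>T. c x *\<^sub>C x)"
    using a by (auto simp: cspan_eq cvs.span_explicit)
  have mem: "(cnj (c x) * c y) *\<^sub>C (star x * y) \<in> V" if "x \<in> T" "y \<in> T" for x y
    using that T B V2 by blast
  have mem2: "(\<Sum>y\<in>T. (cnj (c x) * c y) *\<^sub>C (star x * y)) \<in> V" if "x \<in> T" for x
  proof -
    have "(\<Sum>y\<in>S. (cnj (c x) * c y) *\<^sub>C (star x * y)) \<in> V" if "S \<subseteq> T" for S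
      using finite_subset[OF that T(1)] that
      by (induction S rule: finite_induct) (use V0 V1 mem \<open>x \<in> T\<close> in auto)
    then show ?thesis by blast
  qed
  have "star a * a = (\<Sum>x\<in>T. \<Sum>y\<in>T. (cnj (c x) * c y) *\<^sub>C (star x * y))"
    by (simp add: a_eq star_sum star_scaleC sum_product mult_scaleC_left mult_scaleC_right scaleC_scaleC
        mult.commute[of "c _"])
  then have "h (star a * a) = (\<Sum>x\<in>T. \<Sum>y\<in>T. h ((cnj (c x) * c y) *\<^sub>C (star x * y)))"
    by (simp add: clinear_on_sum[OF h V0 V1] mem mem2)
  also have "\<dots> = (\<Sum>x\<in>T. \<Sum>y\<in>T. cnj (c x) * c y * h (star x * y))"
    using T B clinear_onD(2)[OF h] by (intro sum.cong refl) (auto simp: scaleC_complex_def subset_iff)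
  also have "\<dots> = (\<Sum>x\<in>T. \<Sum>y\<in>T. if x = y then cnj (c x) * c x * r else 0)"
    using T orth by (intro sum.cong refl) (auto simp: subset_iff)
  also have "\<dots> = (\<Sum>x\<in>T. complex_of_real ((cmod (c x))\<^sup>2 * r))"
    using T by (auto intro!: sum.cong simp: complex_norm_square[symmetric] mult.commute)
  finally have eq: "h (star a * a) = complex_of_real (\<Sum>x\<in>T. (cmod (c x))\<^sup>2 * r)"
    by simp
  moreover have "(\<Sum>x\<in>T. (cmod (c x))\<^sup>2 * r) = 0 \<longrightarrow> a = 0"
  proof
    assume "(\<Sum>x\<in>T. (cmod (c x))\<^sup>2 * r) = 0"
    then have "\<forall>x\<in>T. (cmod (c x))\<^sup>2 * r = 0"
      using T(1) r by (subst (asm) sum_nonneg_eq_0_iff) auto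
    then show "a = 0" unfolding a_eq using r by (intro sum.neutral) auto
  qed
  ultimately show ?thesis
    using r by (intro exI[of _ "\<Sum>x\<in>T. (cmod (c x))\<^sup>2 * r"]) (auto intro!: sum_nonneg)
qed

section \<open>Graded families of isometries\<close>

lemma cspan_star:
  fixes A C :: "'a::cstar_algebra set"
  assumes "\<And>x. x \<in> A \<Longrightarrow> star x \<in> cspan C" and "a \<in> cspan A"
  shows "star a \<in> cspan C"
  using assms(2)
  by (induction rule: cspan_induct) (auto simp: star_add star_scaleC intro: cspan_add cspan_scaleC assms(1))

lemma cspan_mult:
  fixes A B C :: "'a::complex_algebra set"
  assumes AB: "\<And>x y. \<lbrakk>x \<in> A; y \<in> B\<rbrakk> \<Longrightarrow> x * y \<in> cspan C" and a: "a \<in> cspan A" and b: "b \<in> cspan B"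
  shows "a * b \<in> cspan C"
  using a
proof (induction rule: cspan_induct)
  case (base c x)
  have "x * b \<in> cspan C"
    using b by (induction rule: cspan_induct)
      (auto simp: distrib_left mult_scaleC_right intro: cspan_add cspan_scaleC AB base)
  then show ?case by (simp add: mult_scaleC_left cspan_scaleC)
qed (auto simp: distrib_right intro: cspan_add)

text \<open>Linearity in a is asked for only at generators b; the extension goes over a first and
  then over b. The two generating sets may differ, so they can be chosen to make products of
  generators computable.\<close>

lemma bilinear_eqI:
  assumes "\<And>b. b \<in> B \<Longrightarrow> clinear_on (cspan A) (\<lambda>a. F a b)"
    and "\<And>b. b \<in> B \<Longrightarrow> clinear_on (cspan A) (\<lambda>a. G a b)"
    and "\<And>a. a \<in> cspan A \<Longrightarrow> clinear_on (cspan B) (F a)"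
    and "\<And>a. a \<in> cspan A \<Longrightarrow> clinear_on (cspan B) (G a)"
    and "\<And>a b. \<lbrakk>a \<in> A; b \<in> B\<rbrakk> \<Longrightarrow> F a b = G a b" and a: "a \<in> cspan A" and b: "b \<in> cspan B"
  shows "F a b = G a b"
proof (rule clinear_on_eqI[OF assms(3)[OF a] assms(4)[OF a] subset_refl _ b])
  fix y assume "y \<in> B"
  then show "F a y = G a y"
    using clinear_on_eqI[OF assms(1,2) subset_refl assms(5) a] by blast
qed

text \<open>In the intended instance \<open>W d\<close> is the set of the isometries \<open>s\<^sub>u\<close> with \<open>u\<close> of degree \<open>d\<close>, so that
  no explicit normal form for the elements of the semigroup is needed.\<close>

locale graded_frames =
  fixes m n :: nat and W :: "nat \<times> nat \<Rightarrow> 'a::cstar_algebra set"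
  assumes m_pos: "m > 0" and n_pos: "n > 0"
    and frame_W: "frame (W d)"
    and card_W: "card (W d) = m ^ fst d * n ^ snd d"
    and W_mult: "\<lbrakk>x \<in> W d; y \<in> W e\<rbrakk> \<Longrightarrow> x * y \<in> W (d + e)"
    and W_0: "W 0 = {1}"
begin

definition units :: "nat \<times> nat \<Rightarrow> nat \<times> nat \<Rightarrow> 'a set"
  where "units d e = {x * star y |x y. x \<in> W d \<and> y \<in> W e}"

definition core :: "'a set"
  where "core = cspan (\<Union>d e. units d e)"

text \<open>The elements of \<open>block k\<close> will form an orthogonal family for \<open>\<langle>a|b\<rangle> = \<omega> (a\<^sup>* b)\<close> that consists of
  eigenvectors of the modular group.\<close>

definition block :: "nat \<Rightarrow> 'a set"
  where "block k = (\<Union>d. units d (k, k))"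

lemma unitsI: "\<lbrakk>x \<in> W d; y \<in> W e\<rbrakk> \<Longrightarrow> x * star y \<in> units d e"
  by (auto simp: units_def)

lemma star_units: "a \<in> units d e \<Longrightarrow> star a \<in> units e d"
  by (auto simp: units_def star_mult star_star) blast

lemma units_core: "a \<in> units d e \<Longrightarrow> a \<in> core"
  unfolding core_def by (rule cspan_base) blast

lemma W_core: "x \<in> W d \<Longrightarrow> x \<in> core"
  using units_core[OF unitsI[of x d 1 0]] by (simp add: W_0)

lemma card_pos: "card (W d) > 0"
  using m_pos n_pos by (simp add: card_W)

lemma card_add: "card (W (d + e)) = card (W d) * card (W e)"
  by (simp add: card_W power_add)

lemma one_core: "1 \<in> core"
  using W_core[of 1 0] by (simp add: W_0)

lemma core_0: "0 \<in> core"
  and core_add: "\<lbrakk>a \<in> core; b \<in> core\<rbrakk> \<Longrightarrow> a + b \<in> core"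
  and core_diff: "\<lbrakk>a \<in> core; b \<in> core\<rbrakk> \<Longrightarrow> a - b \<in> core"
  and core_scaleC: "a \<in> core \<Longrightarrow> c *\<^sub>C a \<in> core"
  by (auto simp: core_def intro: cspan_add cspan_diff cspan_scaleC)

text \<open>An isometry cancels on the left, so cancelling w on the right needs another reason: if x
  and y differed, \<open>star y * x\<close> would be 0, whereas squeezing it between
  \<open>star w\<close> and \<open>w\<close> gives 1.\<close>

lemma W_mult_eq_iff: "\<lbrakk>x \<in> W d; y \<in> W d; w \<in> W e\<rbrakk> \<Longrightarrow> x * w = y * w \<longleftrightarrow> x = y"
proof
  assume x: "x \<in> W d" and y: "y \<in> W d" and w: "w \<in> W e" and eq: "x * w = y * w"
  have "star w * (star y * x) * w = star (y * w) * (x * w)" by (simp add: star_mult mult.assoc)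
  also have "\<dots> = 1" unfolding eq using frame_star_mult[OF frame_W W_mult[OF y w] W_mult[OF y w]] by simp
  finally show "x = y" using frame_star_mult[OF frame_W y x] by (auto split: if_splits)
qed simp

lemma units_expand: "x * star y = (\<Sum>w\<in>W p. (x * w) * star (y * w))"
proof -
  have "(\<Sum>w\<in>W p. (x * w) * star (y * w)) = x * (\<Sum>w\<in>W p. w * star w) * star y"
    by (simp add: sum_distrib_left sum_distrib_right star_mult mult.assoc)
  then show ?thesis by (simp add: frame_sum[OF frame_W])
qed

lemma units_expand_cspan: "a \<in> units d e \<Longrightarrow> a \<in> cspan (units (d + p) (e + p))"
proof -
  assume "a \<in> units d e"
  then obtain x y where a: "a = x * star y" "x \<in> W d" "y \<in> W e" by (auto simp: units_def)
  show ?thesis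
    unfolding a(1) units_expand[of x y p] using a(2,3)
    by (intro cspan_sum cspan_base unitsI W_mult)
qed

lemma units_mult:
  "\<lbrakk>y \<in> W e; x' \<in> W e\<rbrakk> \<Longrightarrow> (x * star y) * (x' * star y') = (if y = x' then x * star y' else 0)"
proof -
  assume "y \<in> W e" "x' \<in> W e"
  have "(x * star y) * (x' * star y') = x * (star y * x') * star y'" by (simp add: mult.assoc)
  then show ?thesis using frame_star_mult[OF frame_W \<open>y \<in> W e\<close> \<open>x' \<in> W e\<close>] by simp
qed

lemma block_core: "cspan (block k) \<subseteq> core"
  unfolding core_def block_def by (intro cspan_mono) blast

text \<open>All large k, and not just some k, so that two elements find a common one. A right factor
  of degree (p, q) is padded by (k - p, k - q), which is exact once k is at least
  \<open>max p q\<close>; the left degree is left to float.\<close>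

lemma core_block: "a \<in> core \<Longrightarrow> \<exists>K. \<forall>k\<ge>K. a \<in> cspan (block k)"
  unfolding core_def
proof (induction rule: cspan_induct)
  case (add x y)
  then obtain K L where "\<forall>k\<ge>K. x \<in> cspan (block k)" "\<forall>k\<ge>L. y \<in> cspan (block k)" by blast
  then show ?case by (intro exI[of _ "max K L"]) (auto intro: cspan_add)
next
  case (base c x)
  then obtain d p q where x: "x \<in> units d (p, q)" by auto
  have "c *\<^sub>C x \<in> cspan (block k)" if "k \<ge> max p q" for k
  proof (rule cspan_scaleC)
    have "x \<in> cspan (units (d + (k - p, k - q)) ((p, q) + (k - p, k - q)))"
      by (rule units_expand_cspan[OF x])
    moreover have "(p, q) + (k - p, k - q) = (k, k)" using that by simp
    ultimately show "x \<in> cspan (block k)"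
      using cspan_mono[of "units (d + (k - p, k - q)) (k, k)" "block k"] by (auto simp: block_def)
  qed
  then show ?case by blast
qed simp

lemma core_star: "a \<in> core \<Longrightarrow> star a \<in> core"
  unfolding core_def by (rule cspan_star) (auto intro: cspan_base star_units)

lemma core_star_block: "a \<in> cspan (block k) \<Longrightarrow> star a \<in> cspan (star ` block k)"
  by (rule cspan_star) (auto intro: cspan_base)

text \<open>The factors that meet in the product a * b then all have degree (k, k), so that
  \<open>units_mult\<close> evaluates every product of generators. In the product b * a the degree
  (k, k) stands on the outside.\<close>

lemma core_representation:
  assumes "a \<in> core" and "b \<in> core"
  obtains k where "a \<in> cspan (block k)" and "b \<in> cspan (star ` block k)"
proof -
  obtain K L where "\<forall>k\<ge>K. a \<in> cspan (block k)" "\<forall>k\<ge>L. star b \<in> cspan (block k)"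
    using core_block[OF assms(1)] core_block[OF core_star[OF assms(2)]] by blast
  then have "a \<in> cspan (block (max K L))" "star (star b) \<in> cspan (star ` block (max K L))"
    by (auto intro: core_star_block)
  then show thesis using that by (simp add: star_star)
qed

lemma star_block_core: "cspan (star ` block k) \<subseteq> core"
  unfolding core_def by (rule cspan_minimal) (auto simp: block_def intro!: cspan_base dest: star_units)

lemma blockE:
  assumes "a \<in> block k"
  obtains x y d where "a = x * star y" "x \<in> W d" "y \<in> W (k, k)"
  using assms by (auto simp: block_def units_def)

lemma star_blockE:
  assumes "a \<in> star ` block k"
  obtains x y d where "a = x * star y" "x \<in> W (k, k)" "y \<in> W d"
  using assms by (auto simp: block_def units_def star_mult star_star)

lemma core_mult: "\<lbrakk>a \<in> core; b \<in> core\<rbrakk> \<Longrightarrow> a * b \<in> core"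
proof -
  assume "a \<in> core" "b \<in> core"
  then obtain k where k: "a \<in> cspan (block k)" "b \<in> cspan (star ` block k)"
    by (rule core_representation)
  show "a * b \<in> core"
    unfolding core_def
  proof (rule cspan_mult[OF _ k])
    fix a b assume "a \<in> block k" "b \<in> star ` block k"
    then show "a * b \<in> cspan (\<Union>d e. units d e)"
      by (elim blockE star_blockE) (auto simp: units_mult intro!: cspan_base unitsI)
  qed
qed

section \<open>Eigenvalues of the modular group\<close>

definition weight :: "complex \<Rightarrow> nat \<times> nat \<Rightarrow> nat \<times> nat \<Rightarrow> complex"
  where "weight z d e =
    nat_cpow m (z * of_int (int (fst e) - int (fst d))) * nat_cpow n (z * of_int (int (snd e) - int (snd d)))"

lemma weight_exp:
  "weight z d e = exp (z * of_real ((real (fst e) - real (fst d)) * ln (real m) + (real (snd e) - real (snd d)) * ln (real n)))"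
  by (simp add: weight_def nat_cpow_def exp_add[symmetric] algebra_simps)

lemma weight_add: "weight (z + w) d e = weight z d e * weight w d e"
  by (simp add: weight_exp exp_add[symmetric] algebra_simps)

lemma weight_0 [simp]: "weight 0 d e = 1"
  by (simp add: weight_exp)

lemma weight_trans: "weight z d e * weight z e f = weight z d f"
  by (simp add: weight_exp exp_add[symmetric] algebra_simps)

lemma cnj_weight: "cnj (weight z d e) = weight (cnj z) d e"
  by (simp add: weight_exp exp_cnj)

lemma cnj_weight_swap: "cnj (weight z d e) = weight (- cnj z) e d"
  by (simp add: weight_exp exp_cnj algebra_simps)

lemma weight_of_real: "\<exists>r>0. weight (of_real t) d e = complex_of_real r"
  unfolding weight_exp of_real_mult[symmetric] exp_of_real
  using exp_gt_zero by blast

text \<open>The weight at 1 is the quotient of the normalisations of the state on two degrees;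
  \<open>D_one\<close> rests on this.\<close>

lemma weight_1: "weight 1 d e = of_nat (card (W e)) / of_nat (card (W d))"
proof -
  have cpow: "nat_cpow k (of_int (int a - int b)) = of_nat k ^ a / of_nat k ^ b" if "k > 0" for k a b
  proof -
    have "nat_cpow k (of_int (int a - int b)) = complex_of_real (exp (real a * ln (real k) - real b * ln (real k)))"
      by (simp add: nat_cpow_def exp_of_real[symmetric] algebra_simps)
    then show ?thesis using that by (simp add: exp_diff exp_of_nat_mult)
  qed
  show ?thesis unfolding weight_def card_W mult_1_left cpow[OF m_pos] cpow[OF n_pos] by simp
qed

lemma holomorphic_weight: "(\<lambda>z. weight z d e) holomorphic_on UNIV"
  unfolding weight_exp by (intro holomorphic_intros)

end

section \<open>The state and the orthogonal basis\<close>

text \<open>State and modular maps enter only through linearity on \<open>core\<close> and their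
  values on the spanning elements, which keeps integrals, limits and choice operators out of the
  verification of the axioms.\<close>

locale modular_frames = graded_frames m n W
  for m n :: nat and W :: "nat \<times> nat \<Rightarrow> 'a::cstar_algebra set" +
  fixes \<omega> :: "'a \<Rightarrow> complex" and D :: "complex \<Rightarrow> 'a \<Rightarrow> 'a"
  assumes \<omega>_linear: "clinear_on core \<omega>"
    and \<omega>_units: "\<lbrakk>x \<in> W d; y \<in> W e\<rbrakk> \<Longrightarrow>
      \<omega> (x * star y) = (if d = e \<and> x = y then 1 / of_nat (card (W d)) else 0)"
    and D_linear: "clinear_on core (D z)"
    and D_units: "\<lbrakk>x \<in> W d; y \<in> W e\<rbrakk> \<Longrightarrow> D z (x * star y) = weight z d e *\<^sub>C (x * star y)"
begin

lemma \<omega>_add: "\<lbrakk>a \<in> core; b \<in> core\<rbrakk> \<Longrightarrow> \<omega> (a + b) = \<omega> a + \<omega> b"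
  and \<omega>_scaleC: "a \<in> core \<Longrightarrow> \<omega> (c *\<^sub>C a) = c * \<omega> a"
  and D_add: "\<lbrakk>a \<in> core; b \<in> core\<rbrakk> \<Longrightarrow> D z (a + b) = D z a + D z b"
  and D_scaleC: "a \<in> core \<Longrightarrow> D z (c *\<^sub>C a) = c *\<^sub>C D z a"
  using clinear_onD[OF \<omega>_linear] clinear_onD[OF D_linear] by (auto simp: scaleC_complex_def)

lemma \<omega>_0 [simp]: "\<omega> 0 = 0"
  using clinear_on_0[OF \<omega>_linear core_0] .

lemma D_0 [simp]: "D z 0 = 0"
  using clinear_on_0[OF D_linear core_0] .

lemma \<omega>_sum: "(\<And>i. i \<in> I \<Longrightarrow> f i \<in> core) \<Longrightarrow> \<omega> (\<Sum>i\<in>I. f i) = (\<Sum>i\<in>I. \<omega> (f i))"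
  by (rule clinear_on_sum[OF \<omega>_linear core_0 core_add])

lemma D_core: "a \<in> core \<Longrightarrow> D z a \<in> core"
proof -
  assume "a \<in> core"
  then show ?thesis
    unfolding core_def
  proof (induction rule: cspan_induct)
    case (add x y)
    then show ?case by (simp add: D_add core_def[symmetric] core_add)
  next
    case (base c x)
    then obtain d e u v where x: "x = u * star v" "u \<in> W d" "v \<in> W e" by (auto simp: units_def)
    then have "u * star v \<in> core" by (blast intro: units_core unitsI)
    then show ?case
      using D_units[OF x(2,3)] by (simp add: x(1) D_scaleC core_def[symmetric] core_scaleC)
  qed simp
qed

lemma \<omega>_star: "a \<in> core \<Longrightarrow> \<omega> (star a) = cnj (\<omega> a)"
proof -
  assume a: "a \<in> core"
  have "cnj (\<omega> (star a)) = \<omega> a"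
  proof (rule clinear_on_eqI[where f = "\<lambda>a. cnj (\<omega> (star a))", OF _ \<omega>_linear _ _ a[unfolded core_def]])
    show "clinear_on core (\<lambda>a. cnj (\<omega> (star a)))"
      by (simp add: clinear_on_def star_add star_scaleC \<omega>_add \<omega>_scaleC core_star scaleC_complex_def)
    fix x assume "x \<in> (\<Union>d e. units d e)"
    then obtain d e u v where "x = u * star v" "u \<in> W d" "v \<in> W e" by (auto simp: units_def)
    then show "cnj (\<omega> (star x)) = \<omega> x"
      using \<omega>_units[of u d v e] \<omega>_units[of v e u d] by (auto simp: star_mult star_star)
  qed (simp add: core_def)
  then show ?thesis by (metis complex_cnj_cnj)
qed

text \<open>The product has nonzero gauge degree. To see it in terms of spanning elements, the first
  factor is padded by \<open>W d'\<close> and the second by \<open>W e\<close>, so that the inner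
  isometries both get degree e + d'; each surviving term then has different outer degrees d + d' and
  e + e'.\<close>

lemma \<omega>_mult_eq_0:
  assumes "x \<in> W d" "y \<in> W e" "x' \<in> W d'" "y' \<in> W e'" and neq: "d + d' \<noteq> e + e'"
  shows "\<omega> ((x * star y) * (x' * star y')) = 0"
proof -
  let ?t = "\<lambda>w w'. ((x * w) * star (y * w)) * ((x' * w') * star (y' * w'))"
  have t: "?t w w' = (if y * w = x' * w' then (x * w) * star (y' * w') else 0)"
    if "w \<in> W d'" "w' \<in> W e" for w w'
  proof (rule units_mult)
    show "y * w \<in> W (e + d')" using that assms by (intro W_mult)
    show "x' * w' \<in> W (e + d')" using that assms W_mult[of x' d' w' e] by (simp add: add.commute)
  qed
  have t0: "?t w w' \<in> core \<and> \<omega> (?t w w') = 0" if "w \<in> W d'" "w' \<in> W e" for w w'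
  proof -
    have xw: "x * w \<in> W (d + d')" "y' * w' \<in> W (e' + e)" using that assms by (auto intro: W_mult)
    have "(x * w) * star (y' * w') \<in> core" using units_core[OF unitsI[OF xw]] .
    moreover have "\<omega> ((x * w) * star (y' * w')) = 0"
      using \<omega>_units[OF xw] neq by (simp add: add.commute[of e'])
    ultimately show ?thesis unfolding t[OF that] using core_0 by simp
  qed
  have "(x * star y) * (x' * star y') = (\<Sum>w\<in>W d'. \<Sum>w'\<in>W e. ?t w w')"
    unfolding units_expand[of x y d'] units_expand[of x' y' e] sum_product ..
  also have "\<dots> = (\<Sum>p\<in>W d' \<times> W e. ?t (fst p) (snd p))"
    by (simp add: sum.cartesian_product split_beta)
  also have "\<omega> \<dots> = (\<Sum>p\<in>W d' \<times> W e. \<omega> (?t (fst p) (snd p)))"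
    by (rule \<omega>_sum) (use t0 in auto)
  also have "\<dots> = 0"
    by (rule sum.neutral) (use t0 in auto)
  finally show ?thesis .
qed

lemma \<omega>_block_orthogonal:
  assumes "a \<in> block k" "b \<in> block k"
  shows "\<omega> (star a * b) = (if a = b then complex_of_real (1 / card (W (k, k))) else 0)"
proof -
  have val: "\<omega> (star (x * star y) * (x' * star y')) =
      (if (d, x, y) = (d', x', y') then complex_of_real (1 / card (W (k, k))) else 0)"
    if "x \<in> W d" "y \<in> W (k, k)" "x' \<in> W d'" "y' \<in> W (k, k)" for x y x' y' d d'
  proof (cases "d = d'")
    case True
    then show ?thesis
      using that units_mult[of x d x' y y'] \<omega>_units[of y "(k, k)" y' "(k, k)"] by (auto simp: star_mult star_star)
  next
    case False
    then have "(k, k) + d' \<noteq> d + (k, k)" by (simp add: add.commute[of "(k, k)"])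
    then show ?thesis
      using False \<omega>_mult_eq_0[OF that(2,1,3,4)] by (simp add: star_mult star_star)
  qed
  from assms(1) obtain x y d where a: "a = x * star y" "x \<in> W d" "y \<in> W (k, k)" by (rule blockE)
  from assms(2) obtain x' y' d' where b: "b = x' * star y'" "x' \<in> W d'" "y' \<in> W (k, k)" by (rule blockE)
  \<comment> \<open>If a = b, one representation is used for both, so \<open>val\<close> applies
    without knowing that representations are unique; if not, the representing triples must
    differ.\<close>
  show ?thesis
  proof (cases "a = b")
    case True
    then show ?thesis using val[OF a(2,3) a(2,3)] a(1) by simp
  next
    case False
    then show ?thesis using val[OF a(2,3) b(2,3)] a(1) b(1) by auto
  qed
qed

lemma \<omega>_positive:
  assumes "a \<in> core"
  shows "\<exists>q\<ge>0. \<omega> (star a * a) = complex_of_real q \<and> (q = 0 \<longrightarrow> a = 0)"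
proof -
  obtain k where k: "a \<in> cspan (block k)" using core_block[OF assms] by blast
  have "block k \<subseteq> core" using block_core cspan_base by blast
  then show ?thesis
    using card_pos[of "(k, k)"]
    by (intro clinear_form_orthogonal_basis[OF \<omega>_linear core_0 core_add core_scaleC _ \<omega>_block_orthogonal _ k])
      (auto intro: core_mult core_star)
qed

section \<open>Boundedness of left multiplication\<close>

text \<open>The squared norm of the inner product; squares keep the estimates free of roots until
  the axiom itself is checked.\<close>

definition qf :: "'a \<Rightarrow> real"
  where "qf a = Re (\<omega> (star a * a))"

lemma qf_nonneg: "a \<in> core \<Longrightarrow> qf a \<ge> 0"
  using \<omega>_positive[of a] by (auto simp: qf_def)

text \<open>The parallelogram law with the nonnegative term of the difference dropped; it does the
  work of the triangle inequality and explains the factors 2 in later constants.\<close>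

lemma qf_add_le:
  assumes "a \<in> core" "b \<in> core"
  shows "qf (a + b) \<le> 2 * qf a + 2 * qf b"
proof -
  have mem: "star x * y \<in> core" if "x \<in> core" "y \<in> core" for x y using that by (intro core_mult core_star)
  have "star (a + b) * (a + b) + star (a - b) * (a - b) =
      (star a * a + star a * a) + (star b * b + star b * b)"
    by (simp add: star_add star_diff algebra_simps)
  then have "\<omega> (star (a + b) * (a + b)) + \<omega> (star (a - b) * (a - b)) =
      (\<omega> (star a * a) + \<omega> (star a * a)) + (\<omega> (star b * b) + \<omega> (star b * b))"
    using assms by (simp add: \<omega>_add[symmetric] mem core_add core_diff)
  then have "qf (a + b) + qf (a - b) = 2 * qf a + 2 * qf b"
    by (simp add: qf_def complex_eq_iff)
  then show ?thesis using qf_nonneg[OF core_diff[OF assms]] by simp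
qed

lemma qf_scaleC: "a \<in> core \<Longrightarrow> qf (c *\<^sub>C a) = (cmod c)\<^sup>2 * qf a"
  by (simp add: qf_def star_scaleC mult_scaleC_left mult_scaleC_right \<omega>_scaleC core_mult core_star
      scaleC_scaleC complex_norm_square[symmetric] mult.commute[of "cnj c"])

lemma qf_isometry: "x \<in> W d \<Longrightarrow> qf (x * b) = qf b"
proof -
  assume x: "x \<in> W d"
  have "star (x * b) * (x * b) = star b * (star x * x) * b" by (simp add: star_mult mult.assoc)
  then show ?thesis using frame_star_mult[OF frame_W x x] by (simp add: qf_def)
qed

lemma qf_coisometry:
  assumes y: "y \<in> W d" and b: "b \<in> core"
  shows "qf (star y * b) \<le> qf b"
proof -
  have mem: "star v * b \<in> core" if "v \<in> W d" for v using that b by (blast intro: core_mult core_star W_core)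
  have "qf (star y * b) \<le> (\<Sum>v\<in>W d. qf (star v * b))"
    using y mem frame_finite[OF frame_W] by (intro member_le_sum) (auto intro: qf_nonneg)
  also have "\<dots> = Re (\<omega> (\<Sum>v\<in>W d. star (star v * b) * (star v * b)))"
    unfolding qf_def by (subst \<omega>_sum) (auto intro: core_mult core_star mem)
  also have "(\<Sum>v\<in>W d. star (star v * b) * (star v * b)) = star b * (\<Sum>v\<in>W d. v * star v) * b"
    by (simp add: sum_distrib_left sum_distrib_right star_mult star_star mult.assoc)
  finally show ?thesis by (simp add: frame_sum[OF frame_W] qf_def)
qed

lemma qf_mult_bounded: "a \<in> core \<Longrightarrow> \<exists>C\<ge>0. \<forall>b\<in>core. qf (a * b) \<le> C * qf b"
proof -
  assume "a \<in> core"
  then show ?thesis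
    unfolding core_def
  proof (induction rule: cspan_induct)
    case zero
    show ?case by (intro exI[of _ 0]) (simp add: qf_def)
  next
    case (add x y)
    obtain C1 C2 where C: "C1 \<ge> 0" "\<forall>b\<in>core. qf (x * b) \<le> C1 * qf b"
      "C2 \<ge> 0" "\<forall>b\<in>core. qf (y * b) \<le> C2 * qf b"
      using add by (auto simp: core_def)
    have "qf ((x + y) * b) \<le> (2 * C1 + 2 * C2) * qf b" if b: "b \<in> core" for b
    proof -
      have "x * b \<in> core" "y * b \<in> core" using add b by (auto simp: core_def[symmetric] intro: core_mult)
      then have "qf ((x + y) * b) \<le> 2 * qf (x * b) + 2 * qf (y * b)"
        by (simp add: distrib_right qf_add_le)
      moreover have "qf (x * b) \<le> C1 * qf b" "qf (y * b) \<le> C2 * qf b" using C b by auto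
      ultimately show ?thesis by (simp add: distrib_right)
    qed
    then show ?case using C unfolding core_def[symmetric] by (intro exI[of _ "2 * C1 + 2 * C2"]) auto
  next
    case (base c z)
    then obtain d e u v where z: "z = u * star v" "u \<in> W d" "v \<in> W e" by (auto simp: units_def)
    have "qf (c *\<^sub>C z * b) \<le> (cmod c)\<^sup>2 * qf b" if b: "b \<in> core" for b
    proof -
      have "u * (star v * b) \<in> core"
        using z b by (blast intro: core_mult core_star W_core)
      then have "qf (c *\<^sub>C z * b) = (cmod c)\<^sup>2 * qf (star v * b)"
        by (simp add: z(1) mult_scaleC_left mult.assoc qf_scaleC qf_isometry[OF z(2)])
      then show ?thesis using qf_coisometry[OF z(3) b] by (simp add: mult_left_mono)
    qed
    then show ?case unfolding core_def[symmetric] by (intro exI[of _ "(cmod c)\<^sup>2"]) auto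
  qed
qed

section \<open>The axioms on the modular group\<close>

text \<open>For generators with inner degree (k, k) the product is 0 or has the outer degrees only,
  and the weights telescope by \<open>weight_trans\<close>.\<close>

lemma D_mult:
  assumes "a \<in> core" "b \<in> core"
  shows "D z (a * b) = D z a * D z b"
proof -
  obtain k where k: "a \<in> cspan (block k)" "b \<in> cspan (star ` block k)"
    using assms by (rule core_representation)
  have [simp]: "x \<in> core" if "x \<in> cspan (block k) \<or> x \<in> cspan (star ` block k) \<or> x \<in> star ` block k" for x
    using that block_core star_block_core cspan_base by blast
  show ?thesis
  proof (rule bilinear_eqI[OF _ _ _ _ _ k])
    fix a b assume a: "a \<in> block k" and b: "b \<in> star ` block k"
    from a obtain x y d where a: "a = x * star y" "x \<in> W d" "y \<in> W (k, k)" by (rule blockE)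
    from b obtain x' y' e where b: "b = x' * star y'" "x' \<in> W (k, k)" "y' \<in> W e" by (rule star_blockE)
    show "D z (a * b) = D z a * D z b"
      using D_units[OF a(2,3), of z] D_units[OF b(2,3), of z] D_units[OF a(2) b(3), of z]
        weight_trans[of z d "(k, k)" e]
      by (simp add: mult.commute[of "weight z (k, k) e"] a(1) b(1) units_mult[OF a(3) b(2)] mult_scaleC_left mult_scaleC_right scaleC_scaleC)
  qed (simp_all add: clinear_on_def distrib_left distrib_right D_add D_scaleC core_mult
      mult_scaleC_left mult_scaleC_right cspan_add cspan_scaleC)
qed

lemma D_group:
  assumes a: "a \<in> core"
  shows "D (z + w) a = D z (D w a)"
proof (rule clinear_on_eqI[OF D_linear _ _ _ a[unfolded core_def]])
  show "clinear_on core (\<lambda>a. D z (D w a))"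
    by (simp add: clinear_on_def D_add D_scaleC D_core)
  fix x assume "x \<in> (\<Union>d e. units d e)"
  then obtain d e u v where x: "x = u * star v" "u \<in> W d" "v \<in> W e" by (auto simp: units_def)
  then have "u * star v \<in> core" by (blast intro: units_core unitsI)
  then show "D (z + w) x = D z (D w x)"
    using D_units[OF x(2,3)] by (simp add: x(1) D_scaleC scaleC_scaleC weight_add mult.commute)
qed (simp add: core_def)

lemma D_zero:
  assumes a: "a \<in> core"
  shows "D 0 a = a"
proof (rule clinear_on_eqI[OF D_linear _ _ _ a[unfolded core_def]])
  show "clinear_on core (\<lambda>a. a)" by (simp add: clinear_on_def)
  fix x assume "x \<in> (\<Union>d e. units d e)"
  then show "D 0 x = x" by (auto simp: units_def D_units scaleC_one)
qed (simp add: core_def)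

lemma D_star:
  assumes a: "a \<in> core"
  shows "star (D z a) = D (- cnj z) (star a)"
proof -
  have "star (D z a) = star (star (D (- cnj z) (star a)))"
  proof (rule arg_cong[of _ _ star], rule clinear_on_eqI[OF D_linear _ _ _ a[unfolded core_def]])
    show "clinear_on core (\<lambda>a. star (D (- cnj z) (star a)))"
      by (simp add: clinear_on_def D_add D_scaleC star_add star_scaleC core_star)
    fix x assume "x \<in> (\<Union>d e. units d e)"
    then obtain d e u v where x: "x = u * star v" "u \<in> W d" "v \<in> W e" by (auto simp: units_def)
    show "D z x = star (D (- cnj z) (star x))"
      using D_units[OF x(2,3), of z] D_units[OF x(3,2), of "- cnj z"]
      by (simp add: x(1) star_mult star_star star_scaleC cnj_weight_swap[symmetric])
  qed (simp add: core_def)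
  then show ?thesis by (simp add: star_star)
qed

text \<open>With (k, k) as both outer degrees, the eigenvalues on the two sides depend on the inner
  degrees d and e alone. They agree if d = e, and otherwise the state kills the product.\<close>

lemma D_symmetric:
  assumes "a \<in> core" "b \<in> core"
  shows "\<omega> (star (D z a) * b) = \<omega> (star a * D (cnj z) b)"
proof -
  obtain k where k: "b \<in> cspan (block k)" "star a \<in> cspan (star ` block k)"
    using assms(2) core_star[OF assms(1)] by (rule core_representation)
  have [simp]: "x \<in> core" if "x \<in> cspan (block k) \<or> x \<in> cspan (star ` block k) \<or> x \<in> star ` block k \<or> x \<in> block k" for x
    using that block_core star_block_core cspan_base by blast
  \<comment> \<open>Both sides are conjugate-linear in a; written in terms of \<open>star a\<close>
    they become linear, as \<open>bilinear_eqI\<close> demands.\<close>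
  have "\<omega> (star (D z (star (star a))) * b) = \<omega> (star a * D (cnj z) b)"
  proof (rule bilinear_eqI[where F = "\<lambda>a b. \<omega> (star (D z (star a)) * b)", OF _ _ _ _ _ k(2,1)])
    fix a b assume a: "a \<in> star ` block k" and b: "b \<in> block k"
    from a obtain x y d where a: "a = x * star y" "x \<in> W (k, k)" "y \<in> W d" by (rule star_blockE)
    from b obtain x' y' e where b: "b = x' * star y'" "x' \<in> W e" "y' \<in> W (k, k)" by (rule blockE)
    have "a * b \<in> core" using a b by (blast intro: core_mult units_core unitsI)
    then have "\<omega> (star (D z (star a)) * b) = weight (cnj z) d (k, k) * \<omega> (a * b)"
        "\<omega> (a * D (cnj z) b) = weight (cnj z) e (k, k) * \<omega> (a * b)"
      using D_units[OF a(3,2)] D_units[OF b(2,3)] unfolding a(1) b(1)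
      by (simp_all add: star_mult star_star star_scaleC mult_scaleC_left mult_scaleC_right cnj_weight \<omega>_scaleC)
    moreover have "\<omega> (a * b) = 0" if "d \<noteq> e"
    proof -
      have "(k, k) + e \<noteq> d + (k, k)" using that by (simp add: add.commute[of "(k, k)"])
      then show ?thesis unfolding a(1) b(1) by (rule \<omega>_mult_eq_0[OF a(2,3) b(2,3)])
    qed
    ultimately show "\<omega> (star (D z (star a)) * b) = \<omega> (a * D (cnj z) b)" by (cases "d = e") auto
  qed (simp_all add: clinear_on_def distrib_left distrib_right D_add D_scaleC core_mult core_star D_core star_add
      star_scaleC mult_scaleC_left mult_scaleC_right cspan_add cspan_scaleC \<omega>_add \<omega>_scaleC scaleC_complex_def)
  then show ?thesis by (simp add: star_star)
qed

text \<open>A KMS condition. On generators, a * b can only contribute 1 / card (W d) and b * a only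
  1 / card (W (k, k)), under the same conditions on the isometries; the weight at 1 converts one
  into the other.\<close>

lemma D_one:
  assumes "a \<in> core" "b \<in> core"
  shows "\<omega> (star (D 1 (star a)) * star b) = \<omega> (star b * a)"
proof -
  obtain k where k: "a \<in> cspan (block k)" "star b \<in> cspan (star ` block k)"
    using assms(1) core_star[OF assms(2)] by (rule core_representation)
  have [simp]: "x \<in> core" if "x \<in> cspan (block k) \<or> x \<in> cspan (star ` block k) \<or> x \<in> star ` block k \<or> x \<in> block k" for x
    using that block_core star_block_core cspan_base by blast
  show ?thesis
  proof (rule bilinear_eqI[where F = "\<lambda>a c. \<omega> (star (D 1 (star a)) * c)" and G = "\<lambda>a c. \<omega> (c * a)", OF _ _ _ _ _ k])
    fix a b assume a: "a \<in> block k" and b: "b \<in> star ` block k"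
    from a obtain x y d where a: "a = x * star y" "x \<in> W d" "y \<in> W (k, k)" by (rule blockE)
    from b obtain x' y' e where b: "b = x' * star y'" "x' \<in> W (k, k)" "y' \<in> W e" by (rule star_blockE)
    have "a * b \<in> core" using a b by (blast intro: core_mult units_core unitsI)
    then have "\<omega> (star (D 1 (star a)) * b) = weight 1 (k, k) d * \<omega> (a * b)"
      using D_units[OF a(3,2)] unfolding a(1) b(1)
      by (simp add: star_mult star_star star_scaleC mult_scaleC_left cnj_weight \<omega>_scaleC)
    also have "\<omega> (a * b) = (if d = e \<and> x = y' \<and> y = x' then 1 / of_nat (card (W d)) else 0)"
      using units_mult[OF a(3) b(2)] \<omega>_units[OF a(2) b(3)] by (auto simp: a(1) b(1))
    also have "weight 1 (k, k) d * \<dots> = (if d = e \<and> x = y' \<and> y = x' then 1 / of_nat (card (W (k, k))) else 0)"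
      using card_pos[of d] card_pos[of e] by (auto simp: weight_1)
    also have "\<dots> = \<omega> (b * a)"
    proof (cases "d = e")
      case True
      then show ?thesis
        using units_mult[of y' e x x' y] \<omega>_units[OF b(2) a(3)] a(2) b(3) by (auto simp: a(1) b(1))
    next
      case False
      then have "(k, k) + d \<noteq> e + (k, k)" by (simp add: add.commute[of "(k, k)"])
      then show ?thesis using False \<omega>_mult_eq_0[OF b(2,3) a(2,3)] by (simp add: a(1) b(1))
    qed
    finally show "\<omega> (star (D 1 (star a)) * b) = \<omega> (b * a)" .
  qed (simp_all add: clinear_on_def distrib_left distrib_right D_add D_scaleC core_mult core_star D_core star_add
      star_scaleC mult_scaleC_left mult_scaleC_right cspan_add cspan_scaleC \<omega>_add \<omega>_scaleC scaleC_complex_def)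
qed

lemma D_entire:
  assumes a: "a \<in> core" and "b \<in> core"
  shows "(\<lambda>z. \<omega> (star a * D z b)) holomorphic_on UNIV"
  using assms(2) unfolding core_def
proof (induction rule: cspan_induct)
  case (add x y)
  then have "(\<lambda>z. \<omega> (star a * D z (x + y))) = (\<lambda>z. \<omega> (star a * D z x) + \<omega> (star a * D z y))"
    using a by (simp add: core_def[symmetric] D_add distrib_left \<omega>_add core_mult core_star D_core)
  then show ?case using add by (auto intro: holomorphic_intros)
next
  case (base c x)
  then obtain d e u v where x: "x = u * star v" "u \<in> W d" "v \<in> W e" by (auto simp: units_def)
  then have "x \<in> core" by (blast intro: units_core unitsI)
  then have "(\<lambda>z. \<omega> (star a * D z (c *\<^sub>C x))) = (\<lambda>z. c * weight z d e * \<omega> (star a * x))"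
    using a D_units[OF x(2,3)]
    by (simp add: x(1)[symmetric] D_scaleC mult_scaleC_right scaleC_scaleC \<omega>_scaleC core_mult core_star)
  then show ?case by (auto intro!: holomorphic_intros holomorphic_weight)
qed simp

text \<open>At a real exponent the eigenvalue r of a generator is positive, so 1 + r can be divided
  out. Surjectivity gives the density axiom with distance 0.\<close>

lemma one_plus_D_surj:
  assumes "a \<in> core"
  shows "\<exists>b\<in>core. b + D (complex_of_real t) b = a"
  using assms unfolding core_def
proof (induction rule: cspan_induct)
  case zero
  show ?case by (intro bexI[of _ 0]) auto
next
  case (add x y)
  then obtain b c where "b \<in> core" "b + D (complex_of_real t) b = x" "c \<in> core" "c + D (complex_of_real t) c = y"
    by (auto simp: core_def)
  then show ?case
    unfolding core_def[symmetric] by (intro bexI[of _ "b + c"]) (auto simp: D_add core_add ac_simps)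
next
  case (base c x)
  then obtain d e u v where x: "x = u * star v" "u \<in> W d" "v \<in> W e" by (auto simp: units_def)
  then have "x \<in> core" by (blast intro: units_core unitsI)
  obtain r where r: "r > 0" "weight (of_real t) d e = complex_of_real r" using weight_of_real by blast
  define k where "k = c / (1 + complex_of_real r)"
  have "1 + complex_of_real r \<noteq> 0"
    using r(1) by (metis add_pos_pos less_irrefl of_real_1 of_real_add of_real_eq_0_iff zero_less_one)
  then have "k * (1 + complex_of_real r) = c" by (simp add: k_def)
  then have "k + k * complex_of_real r = c" by (simp add: distrib_left)
  then have "k *\<^sub>C x + D (complex_of_real t) (k *\<^sub>C x) = c *\<^sub>C x"
    using \<open>x \<in> core\<close> D_units[OF x(2,3), of "complex_of_real t"]
    by (simp add: x(1)[symmetric] D_scaleC r(2) scaleC_scaleC scaleC_add_left[symmetric])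
  then show ?case using \<open>x \<in> core\<close> unfolding core_def[symmetric] by (blast intro: core_scaleC)
qed

theorem modular_hilbert_algebra_core:
  "modular_hilbert_algebra core star (\<lambda>a b. \<omega> (star a * b)) D"
proof
  note mem = core_mult core_star D_core
  show "0 \<in> core" by (rule core_0)
  fix a assume a: "a \<in> core"
  show "c *\<^sub>C a \<in> core" for c using a by (rule core_scaleC)
  show "star a \<in> core" using a by (rule core_star)
  show "star (c *\<^sub>C a) = cnj c *\<^sub>C star a" for c by (rule star_scaleC)
  show "star (star a) = a" by (rule star_star)
  show "clinear_on core (\<lambda>b. \<omega> (star a * b))"
    using a by (simp add: clinear_on_def distrib_left mult_scaleC_right \<omega>_add \<omega>_scaleC mem scaleC_complex_def)
  show "0 \<le> Re (\<omega> (star a * a))" using \<omega>_positive[OF a] by auto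
  show "\<omega> (star a * a) = 0 \<Longrightarrow> a = 0" using \<omega>_positive[OF a] by auto
  show "D (z + w) a = D z (D w a)" for z w using a by (rule D_group)
  show "star (D z a) = D (- cnj z) (star a)" for z using a by (rule D_star)
  show "\<exists>C. \<forall>b\<in>core. ip_norm (\<lambda>a b. \<omega> (star a * b)) (a * b) \<le> C * ip_norm (\<lambda>a b. \<omega> (star a * b)) b"
  proof -
    obtain C where "C \<ge> 0" "\<forall>b\<in>core. qf (a * b) \<le> C * qf b" using qf_mult_bounded[OF a] by blast
    then show ?thesis
      unfolding ip_norm_def qf_def[symmetric]
      by (intro exI[of _ "sqrt C"]) (auto simp: real_sqrt_mult[symmetric])
  qed
  fix b assume b: "b \<in> core"
  show "a + b \<in> core" "a * b \<in> core" using a b by (auto intro: core_add core_mult)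
  show "star (a + b) = star a + star b" "star (a * b) = star b * star a" by (simp_all add: star_add star_mult)
  show "\<omega> (star b * a) = cnj (\<omega> (star a * b))"
    using \<omega>_star[of "star a * b"] a b by (simp add: star_mult star_star mem)
  show "D z (a * b) = D z a * D z b" for z using a b by (rule D_mult)
  show "\<omega> (star (a * b) * c) = \<omega> (star b * (star a * c))" for c by (simp add: star_mult mult.assoc)
  show "\<omega> (star (D z a) * b) = \<omega> (star a * D (cnj z) b)" for z using a b by (rule D_symmetric)
  show "\<omega> (star (D 1 (star a)) * star b) = \<omega> (star b * a)" using a b by (rule D_one)
  show "(\<lambda>z. \<omega> (star a * D z b)) holomorphic_on UNIV" using a b by (rule D_entire)
next
  fix z
  show "clinear_on core (D z)" by (rule D_linear)
  show "bij_betw (D z) core core"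
    by (rule bij_betw_byWitness[of _ "D (- z)"]) (auto simp: D_group[symmetric] D_zero D_core)
next
  \<comment> \<open>Since \<open>1\<close> lies in \<open>core\<close>, every element is itself a
    product, and the span of products is all of \<open>core\<close>.\<close>
  have "core \<subseteq> cspan {a * b |a b. a \<in> core \<and> b \<in> core}"
    using one_core by (auto intro!: cspan_base) (metis mult_1_right)
  moreover have "cspan {a * b |a b. a \<in> core \<and> b \<in> core} \<subseteq> core"
    unfolding core_def by (rule cspan_minimal) (auto simp: core_def[symmetric] intro: core_mult)
  ultimately show "ip_dense (\<lambda>a b. \<omega> (star a * b)) core (cspan {a * b |a b. a \<in> core \<and> b \<in> core})"
    by (auto simp: ip_dense_def ip_norm_def intro!: bexI)
next
  fix t :: real
  have "(\<lambda>a. a + D (complex_of_real t) a) ` core = core"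
    using one_plus_D_surj[of _ t] by (force intro: core_add D_core)
  then show "ip_dense (\<lambda>a b. \<omega> (star a * b)) core ((\<lambda>a. a + D (complex_of_real t) a) ` core)"
    by (auto simp: ip_dense_def ip_norm_def intro!: bexI)
qed

end

section \<open>The normalised trace\<close>

lemma bounded_linear_scaleC_right: "bounded_linear (\<lambda>x :: 'a::cstar_algebra. c *\<^sub>C x)"
  by (rule bounded_linear_intro[of _ "cmod c"])
    (simp_all add: scaleC_add_right scaleR_scaleC scaleC_scaleC norm_scaleC mult.commute)

lemma bounded_linear_scaleC_left: "bounded_linear (\<lambda>c. c *\<^sub>C (x :: 'a::cstar_algebra))"
proof (rule bounded_linear_intro[of _ "norm x"])
  show "(r *\<^sub>R c) *\<^sub>C x = r *\<^sub>R (c *\<^sub>C x)" for r :: real and c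
    by (simp add: scaleR_conv_of_real[of r c] scaleR_scaleC[of r "c *\<^sub>C x"] scaleC_scaleC)
qed (simp_all add: scaleC_add_left norm_scaleC)

lemma bounded_linear_star: "bounded_linear (star :: 'a::cstar_algebra \<Rightarrow> 'a)"
  by (rule bounded_linear_intro[of _ 1]) (simp_all add: star_add scaleR_scaleC star_scaleC)

lemma of_nat_scaleC: "of_nat k = of_nat k *\<^sub>C (1 :: 'a::cstar_algebra)"
  by (induction k) (simp_all add: scaleC_add_left scaleC_one)

context graded_frames
begin

definition diag :: "nat \<Rightarrow> 'a set"
  where "diag k = cspan (units (k, k) (k, k))"

definition diag_union :: "'a set"
  where "diag_union = (\<Union>k\<in>{1..}. diag k)"

lemma diag_mono: "k \<le> j \<Longrightarrow> diag k \<subseteq> diag j"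
  unfolding diag_def using units_expand_cspan[of _ "(k, k)" "(k, k)" "(j - k, j - k)"]
  by (intro cspan_minimal) simp

lemma diag_union_common:
  assumes "x \<in> diag_union" "y \<in> diag_union"
  obtains k where "k \<ge> 1" "x \<in> diag k" "y \<in> diag k"
proof -
  obtain k j where "k \<ge> 1" "x \<in> diag k" "j \<ge> 1" "y \<in> diag j"
    using assms by (auto simp: diag_union_def)
  then show thesis
    using diag_mono[of k "max k j"] diag_mono[of j "max k j"] by (intro that[of "max k j"]) auto
qed

lemma diag_unionI: "\<lbrakk>k \<ge> 1; x \<in> diag k\<rbrakk> \<Longrightarrow> x \<in> diag_union"
  by (auto simp: diag_union_def)

lemma diag_mult: "\<lbrakk>x \<in> diag k; y \<in> diag k\<rbrakk> \<Longrightarrow> x * y \<in> diag k"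
  unfolding diag_def
proof (rule cspan_mult)
  fix a b assume "a \<in> units (k, k) (k, k)" "b \<in> units (k, k) (k, k)"
  then obtain x y x' y' where "a = x * star y" "x \<in> W (k, k)" "y \<in> W (k, k)"
    "b = x' * star y'" "x' \<in> W (k, k)" "y' \<in> W (k, k)" by (auto simp: units_def)
  then show "a * b \<in> cspan (units (k, k) (k, k))"
    by (auto simp: units_mult intro!: cspan_base unitsI)
qed

lemma diag_star: "x \<in> diag k \<Longrightarrow> star x \<in> diag k"
  unfolding diag_def by (rule cspan_star) (auto intro: cspan_base star_units)

lemma diag_union_0: "0 \<in> diag_union"
  by (rule diag_unionI[of 1]) (auto simp: diag_def)

lemma diag_union_add: "\<lbrakk>x \<in> diag_union; y \<in> diag_union\<rbrakk> \<Longrightarrow> x + y \<in> diag_union"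
  by (erule (1) diag_union_common, erule diag_unionI) (auto simp: diag_def intro: cspan_add)

lemma diag_union_mult: "\<lbrakk>x \<in> diag_union; y \<in> diag_union\<rbrakk> \<Longrightarrow> x * y \<in> diag_union"
  by (erule (1) diag_union_common, erule diag_unionI) (rule diag_mult)

lemma diag_union_scaleC: "x \<in> diag_union \<Longrightarrow> c *\<^sub>C x \<in> diag_union"
  by (auto simp: diag_union_def diag_def intro: cspan_scaleC)

lemma diag_union_star: "x \<in> diag_union \<Longrightarrow> star x \<in> diag_union"
  by (auto simp: diag_union_def intro: diag_star)

lemma units_diag_union: "a \<in> units d d \<Longrightarrow> a \<in> diag_union"
proof -
  assume a: "a \<in> units d d"
  obtain p q where d: "d = (p, q)" by (cases d)
  \<comment> \<open>The successor ensures K \<ge> 1, because the union defining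
    \<open>diag_union\<close> starts at 1.\<close>
  define K where "K = Suc (max p q)"
  have "d + (K - p, K - q) = (K, K)" by (auto simp: d K_def)
  then show ?thesis
    using units_expand_cspan[OF a, of "(K - p, K - q)"] by (intro diag_unionI[of K]) (auto simp: diag_def K_def)
qed

text \<open>On \<open>diag k\<close> the maps \<open>avg j\<close> with \<open>j \<ge> k\<close> are all equal to the normalised trace times the unit;
  being contractions, they converge on the closure.\<close>

definition avg :: "nat \<Rightarrow> 'a \<Rightarrow> 'a"
  where "avg k x = (1 / of_nat (card (W (k, k)))) *\<^sub>C (\<Sum>w\<in>W (k, k). star w * x * w)"

lemma avg_add: "avg k (x + y) = avg k x + avg k y"
  by (simp add: avg_def distrib_left distrib_right sum.distrib scaleC_add_right)

lemma avg_scaleC: "avg k (c *\<^sub>C x) = c *\<^sub>C avg k x"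
  by (simp add: avg_def mult_scaleC_left mult_scaleC_right scaleC_sum_right[symmetric] scaleC_scaleC mult.commute)

lemma avg_diff: "avg k (x - y) = avg k x - avg k y"
  by (metis avg_add add_diff_cancel_right' diff_add_cancel)

lemma avg_one: "avg k 1 = 1"
proof -
  have "star w * 1 * w = 1" if "w \<in> W (k, k)" for w
    using frame_star_mult[OF frame_W that that] by simp
  then have "(\<Sum>w\<in>W (k, k). star w * 1 * w) = (\<Sum>w\<in>W (k, k). 1)"
    by (rule sum.cong[OF HOL.refl])
  then show ?thesis using card_pos[of "(k, k)"] by (simp add: avg_def of_nat_scaleC[where 'a = 'a] scaleC_scaleC scaleC_one)
qed

lemma norm_avg_le: "norm (avg k x) \<le> norm x"
proof -
  have "norm (star w * x * w) \<le> norm x" if "w \<in> W (k, k)" for w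
  proof -
    have "norm w = 1" using frame_star_mult[OF frame_W that that] by (intro norm_isometry) simp
    then show ?thesis using norm_mult_ineq[of "star w * x" w] norm_mult_ineq[of "star w" x] by simp
  qed
  then have "norm (\<Sum>w\<in>W (k, k). star w * x * w) \<le> of_nat (card (W (k, k))) * norm x"
    by (rule sum_norm_bound)
  then show ?thesis using card_pos[of "(k, k)"] by (simp add: avg_def norm_scaleC norm_divide field_simps)
qed

text \<open>After padding by v of degree p, a term survives only for w = a v = b v, that is, if a =
  b. There are then \<open>card (W p)\<close> terms, and dividing by \<open>card (W (j, j))\<close>
  leaves a value independent of j.\<close>

lemma avg_units:
  assumes a: "a \<in> W (k, k)" and b: "b \<in> W (k, k)" and "k \<le> j"
  shows "avg j (a * star b) = (if a = b then 1 / of_nat (card (W (k, k))) else 0) *\<^sub>C 1"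
proof -
  define p where "p = (j - k, j - k)"
  have kp: "(k, k) + p = (j, j)" using \<open>k \<le> j\<close> by (simp add: p_def)
  have mem: "a * v \<in> W (j, j)" "b * v \<in> W (j, j)" if "v \<in> W p" for v
    using W_mult[OF a that] W_mult[OF b that] by (simp_all add: kp)
  have "(\<Sum>w\<in>W (j, j). star w * (a * star b) * w) =
      (\<Sum>w\<in>W (j, j). \<Sum>v\<in>W p. (star w * (a * v)) * (star (b * v) * w))"
    unfolding units_expand[of a b p] by (simp add: sum_distrib_left sum_distrib_right mult.assoc)
  also have "\<dots> = (\<Sum>v\<in>W p. \<Sum>w\<in>W (j, j). if w = a * v then (if b * v = w then 1 else 0) else 0)"
    by (subst sum.swap) (auto intro!: sum.cong simp: frame_star_mult[OF frame_W _ mem(1)] frame_star_mult[OF frame_W mem(2)])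
  also have "\<dots> = (\<Sum>v\<in>W p. if a = b then 1 else 0)"
    using mem frame_finite[OF frame_W] W_mult_eq_iff[OF b a] by (intro sum.cong HOL.refl) auto
  also have "\<dots> = (if a = b then of_nat (card (W p)) else 0) *\<^sub>C 1"
    by (simp add: of_nat_scaleC[where 'a = 'a])
  finally show ?thesis
    using card_add[of "(k, k)" p] card_pos[of p] card_pos[of "(k, k)"]
    by (simp add: avg_def kp scaleC_scaleC)
qed

lemma avg_diag: "x \<in> diag k \<Longrightarrow> \<exists>c. \<forall>j\<ge>k. avg j x = c *\<^sub>C 1"
  unfolding diag_def
proof (induction rule: cspan_induct)
  case zero
  have "avg j 0 = 0 *\<^sub>C 1" for j by (simp add: avg_def)
  then show ?case by blast
next
  case (add x y)
  then obtain c d where "\<forall>j\<ge>k. avg j x = c *\<^sub>C 1" "\<forall>j\<ge>k. avg j y = d *\<^sub>C 1" by blast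
  then show ?case by (intro exI[of _ "c + d"]) (simp add: avg_add scaleC_add_left)
next
  case (base c x)
  then show ?case
    by (auto simp: units_def avg_scaleC avg_units scaleC_scaleC simp del: cvs.scale_zero_left)
qed

definition tr :: "'a \<Rightarrow> complex"
  where "tr x = (SOME c. (\<lambda>j. avg j x) \<longlonglongrightarrow> c *\<^sub>C 1)"

lemma tr_eqI: "(\<lambda>j. avg j x) \<longlonglongrightarrow> c *\<^sub>C 1 \<Longrightarrow> tr x = c"
  unfolding tr_def by (rule some_equality) (auto dest: LIMSEQ_unique)

lemma tr_eqI': "(\<And>j. j \<ge> k \<Longrightarrow> avg j x = c *\<^sub>C 1) \<Longrightarrow> tr x = c"
  by (intro tr_eqI tendsto_eventually eventually_sequentiallyI)

lemma tr_units: "\<lbrakk>a \<in> W (k, k); b \<in> W (k, k)\<rbrakk> \<Longrightarrow> tr (a * star b) = (if a = b then 1 / of_nat (card (W (k, k))) else 0)"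
  by (rule tr_eqI'[of k]) (rule avg_units)

lemma avg_tendsto_diag_union:
  assumes "x \<in> diag_union"
  shows "(\<lambda>j. avg j x) \<longlonglongrightarrow> tr x *\<^sub>C 1"
proof -
  obtain k where "x \<in> diag k" using assms by (auto simp: diag_union_def)
  then obtain c where c: "\<forall>j\<ge>k. avg j x = c *\<^sub>C 1" using avg_diag by blast
  then have "tr x = c" by (intro tr_eqI'[of k]) auto
  then show ?thesis using c by (intro tendsto_eventually eventually_sequentiallyI[of k]) auto
qed

lemma tr_dist_le:
  assumes "(\<lambda>j. avg j x) \<longlonglongrightarrow> tr x *\<^sub>C 1" and "(\<lambda>j. avg j y) \<longlonglongrightarrow> tr y *\<^sub>C 1"
  shows "dist (tr x) (tr y) \<le> dist x y"
proof -
  have "(\<lambda>j. norm (avg j x - avg j y)) \<longlonglongrightarrow> norm (tr x *\<^sub>C 1 - tr y *\<^sub>C (1 :: 'a))"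
    by (intro tendsto_intros assms)
  then have "norm (tr x *\<^sub>C 1 - tr y *\<^sub>C (1 :: 'a)) \<le> norm (x - y)"
    by (rule LIMSEQ_le_const2) (auto simp: avg_diff[symmetric] norm_avg_le)
  then show ?thesis
    by (simp add: cvs.scale_left_diff_distrib[symmetric] norm_scaleC dist_norm)
qed

text \<open>On the union \<open>tr\<close> does not increase distances, so \<open>tr (X i)\<close>
  converges to some c. All \<open>avg j\<close> are contractions, hence the approximation by
  \<open>X i\<close> is uniform in j and the averages of x converge to c. Only then is the chosen
  scalar \<open>tr x\<close> known to be c.\<close>

lemma avg_tendsto:
  assumes "x \<in> closure diag_union"
  shows "(\<lambda>j. avg j x) \<longlonglongrightarrow> tr x *\<^sub>C 1"
proof -
  obtain X where X: "\<And>i. X i \<in> diag_union" "X \<longlonglongrightarrow> x"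
    using assms unfolding closure_sequential by blast
  note Xt = avg_tendsto_diag_union[OF X(1)]
  have "Cauchy X" using X(2) by (rule LIMSEQ_imp_Cauchy)
  then have "Cauchy (\<lambda>i. tr (X i))"
    unfolding Cauchy_def using tr_dist_le[OF Xt Xt] by (meson le_less_trans)
  then obtain c where c: "(\<lambda>i. tr (X i)) \<longlonglongrightarrow> c"
    unfolding Cauchy_convergent_iff convergent_def by blast
  have "(\<lambda>j. avg j x) \<longlonglongrightarrow> c *\<^sub>C 1"
  proof (rule metric_LIMSEQ_I)
    fix e :: real assume "e > 0"
    then have e: "e / 3 > 0" by simp
    have "\<forall>\<^sub>F i in sequentially. dist (X i) x < e / 3 \<and> dist (tr (X i)) c < e / 3"
      using tendstoD[OF X(2) e] tendstoD[OF c e] by (rule eventually_conj)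
    then obtain i where i: "dist (X i) x < e / 3" "dist (tr (X i)) c < e / 3"
      using eventually_happens'[OF sequentially_bot] by blast
    obtain N where N: "\<And>j. j \<ge> N \<Longrightarrow> dist (avg j (X i)) (tr (X i) *\<^sub>C 1) < e / 3"
      using metric_LIMSEQ_D[OF Xt e] by blast
    have "dist (avg j x) (c *\<^sub>C 1) < e" if "j \<ge> N" for j
    proof -
      have "dist (avg j x) (avg j (X i)) \<le> dist (X i) x"
        using norm_avg_le[of j "x - X i"] by (simp add: dist_norm avg_diff norm_minus_commute)
      moreover have "dist (tr (X i) *\<^sub>C (1 :: 'a)) (c *\<^sub>C 1) = dist (tr (X i)) c"
        by (simp add: dist_norm cvs.scale_left_diff_distrib[symmetric] norm_scaleC)
      ultimately show ?thesis
        using i N[OF that] dist_triangle[of "avg j x" "c *\<^sub>C 1" "tr (X i) *\<^sub>C 1"]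
          dist_triangle[of "avg j x" "tr (X i) *\<^sub>C 1" "avg j (X i)"] by simp
    qed
    then show "\<exists>N. \<forall>j\<ge>N. dist (avg j x) (c *\<^sub>C 1) < e" by blast
  qed
  then show ?thesis using tr_eqI by metis
qed

lemma closure_diag_union_limit:
  "\<lbrakk>\<And>i. X i \<in> diag_union; X \<longlonglongrightarrow> x\<rbrakk> \<Longrightarrow> x \<in> closure diag_union"
  unfolding closure_sequential by blast

lemma diag_union_closure: "x \<in> diag_union \<Longrightarrow> x \<in> closure diag_union"
  using closure_subset by blast

lemma tr_tendsto:
  assumes "\<And>i. X i \<in> diag_union" and "X \<longlonglongrightarrow> x"
  shows "(\<lambda>i. tr (X i)) \<longlonglongrightarrow> tr x"
proof (rule metric_tendsto_imp_tendsto[OF assms(2)])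
  show "\<forall>\<^sub>F i in sequentially. dist (tr (X i)) (tr x) \<le> dist (X i) x"
    using tr_dist_le[OF avg_tendsto[OF diag_union_closure[OF assms(1)]]
        avg_tendsto[OF closure_diag_union_limit[OF assms]]] by simp
qed

lemma closure_diag_union_0: "0 \<in> closure diag_union"
  by (rule diag_union_closure[OF diag_union_0])

lemma closure_diag_union_add:
  assumes "x \<in> closure diag_union" "y \<in> closure diag_union"
  shows "x + y \<in> closure diag_union"
proof -
  obtain X Y where "\<And>i. X i \<in> diag_union" "X \<longlonglongrightarrow> x" "\<And>i. Y i \<in> diag_union" "Y \<longlonglongrightarrow> y"
    using assms unfolding closure_sequential by metis
  then show ?thesis
    by (intro closure_diag_union_limit[of "\<lambda>i. X i + Y i"]) (auto intro: diag_union_add tendsto_add)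
qed

lemma closure_diag_union_scaleC:
  assumes "x \<in> closure diag_union"
  shows "c *\<^sub>C x \<in> closure diag_union"
proof -
  obtain X where "\<And>i. X i \<in> diag_union" "X \<longlonglongrightarrow> x"
    using assms unfolding closure_sequential by metis
  then show ?thesis
    by (intro closure_diag_union_limit[of "\<lambda>i. c *\<^sub>C X i"])
      (auto intro: diag_union_scaleC bounded_linear.tendsto[OF bounded_linear_scaleC_right])
qed

lemma tr_linear: "clinear_on (closure diag_union) tr"
  unfolding clinear_on_def
proof (intro conjI ballI allI)
  fix x assume x: "x \<in> closure diag_union"
  have "(\<lambda>j. avg j (c *\<^sub>C x)) \<longlonglongrightarrow> (c * tr x) *\<^sub>C 1" for c
    unfolding avg_scaleC scaleC_scaleC[symmetric]
    by (intro bounded_linear.tendsto[OF bounded_linear_scaleC_right] avg_tendsto x)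
  then show "tr (c *\<^sub>C x) = c *\<^sub>C tr x" for c by (simp add: tr_eqI scaleC_complex_def)
  fix y assume y: "y \<in> closure diag_union"
  show "tr (x + y) = tr x + tr y"
    unfolding tr_eqI[OF tendsto_add[OF avg_tendsto[OF x] avg_tendsto[OF y], folded avg_add scaleC_add_left]] ..
qed

lemma tr_commute_diag:
  assumes "x \<in> diag k" "y \<in> diag k" "k \<ge> 1"
  shows "tr (x * y) = tr (y * x)"
proof (rule bilinear_eqI[where F = "\<lambda>x y. tr (x * y)" and G = "\<lambda>x y. tr (y * x)",
      OF _ _ _ _ _ assms(1,2)[unfolded diag_def]])
  have mem: "x \<in> closure diag_union" if "x \<in> diag k" for x
    using diag_union_closure[OF diag_unionI[OF assms(3) that]] .
  have units: "x \<in> diag k" if "x \<in> units (k, k) (k, k)" for x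
    unfolding diag_def using that by (rule cspan_base)
  note lin = clinear_onD[OF tr_linear]
  have lin1: "clinear_on (diag k) (\<lambda>a. tr (a * b))" "clinear_on (diag k) (\<lambda>a. tr (b * a))" if "b \<in> diag k" for b
    using that by (simp_all add: clinear_on_def distrib_left distrib_right mult_scaleC_left mult_scaleC_right lin mem diag_mult)
  show "clinear_on (cspan (units (k, k) (k, k))) (\<lambda>a. tr (a * b))"
      "clinear_on (cspan (units (k, k) (k, k))) (\<lambda>a. tr (b * a))" if "b \<in> units (k, k) (k, k)" for b
    using lin1[OF units[OF that]] by (simp_all add: diag_def)
  show "clinear_on (cspan (units (k, k) (k, k))) (\<lambda>a. tr (a * b))"
      "clinear_on (cspan (units (k, k) (k, k))) (\<lambda>a. tr (b * a))" if "b \<in> cspan (units (k, k) (k, k))" for b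
    using lin1[unfolded diag_def, OF that] by simp_all
  fix a b assume "a \<in> units (k, k) (k, k)" "b \<in> units (k, k) (k, k)"
  then obtain x y x' y' where ab: "a = x * star y" "x \<in> W (k, k)" "y \<in> W (k, k)"
    "b = x' * star y'" "x' \<in> W (k, k)" "y' \<in> W (k, k)" by (auto simp: units_def)
  have "tr 0 = 0" using clinear_on_0[OF tr_linear closure_diag_union_0] .
  moreover have "a * b = (if y = x' then x * star y' else 0)" "b * a = (if y' = x then x' * star y else 0)"
    unfolding ab(1,4) by (rule units_mult[OF ab(3,5)], rule units_mult[OF ab(6,2)])
  ultimately show "tr (a * b) = tr (b * a)"
    by (simp add: tr_units[of _ k] ab)
qed

lemma tr_positive_diag_union:
  assumes "x \<in> diag_union"
  shows "tr (star x * x) \<in> \<real> \<and> 0 \<le> Re (tr (star x * x))"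
proof -
  obtain k where k: "k \<ge> 1" "x \<in> diag k" using assms by (auto simp: diag_union_def)
  have mem: "a \<in> units (k, k) (k, k) \<Longrightarrow> a \<in> diag_union" for a by (rule units_diag_union)
  have "\<exists>q\<ge>0. tr (star x * x) = complex_of_real q \<and> (q = 0 \<longrightarrow> x = 0)"
  proof (rule clinear_form_orthogonal_basis[OF tr_linear closure_diag_union_0 closure_diag_union_add
          closure_diag_union_scaleC _ _ _ k(2)[unfolded diag_def]])
    fix a b assume a: "a \<in> units (k, k) (k, k)" and b: "b \<in> units (k, k) (k, k)"
    show "star a * b \<in> closure diag_union"
      by (intro diag_union_closure diag_union_mult diag_union_star mem a b)
    obtain x y where xy: "a = x * star y" "x \<in> W (k, k)" "y \<in> W (k, k)" using a by (auto simp: units_def)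
    obtain x' y' where xy': "b = x' * star y'" "x' \<in> W (k, k)" "y' \<in> W (k, k)" using b by (auto simp: units_def)
    have 0: "tr 0 = 0" using clinear_on_0[OF tr_linear closure_diag_union_0] .
    have val: "tr (star (x * star y) * (x' * star y')) =
        (if x = x' \<and> y = y' then complex_of_real (1 / card (W (k, k))) else 0)"
      if "x \<in> W (k, k)" "y \<in> W (k, k)" "x' \<in> W (k, k)" "y' \<in> W (k, k)" for x y x' y'
      using units_mult[OF that(1,3)] tr_units[OF that(2,4)] 0 by (auto simp: star_mult star_star)
    show "tr (star a * b) = (if a = b then complex_of_real (1 / card (W (k, k))) else 0)"
    proof (cases "a = b")
      case True
      then show ?thesis using val[OF xy(2,3) xy(2,3)] xy(1) by simp
    next
      case False
      then show ?thesis using val[OF xy(2,3) xy'(2,3)] xy(1) xy'(1) by auto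
    qed
  qed (use card_pos[of "(k, k)"] in auto)
  then show ?thesis by auto
qed

text \<open>Provides the witness without which nothing could be said about the choice in
  \<open>fixed_trace\<close>. Positivity and the trace identity are checked on matrix units and
  carried to the closure by \<open>tr_tendsto\<close>.\<close>

lemma normalized_trace_tr: "normalized_trace_on (closure diag_union) tr"
  unfolding normalized_trace_on_def
proof (intro conjI ballI)
  show "clinear_on (closure diag_union) tr" by (rule tr_linear)
  show "tr 1 = 1" by (rule tr_eqI'[of 0]) (simp add: avg_one scaleC_one)
  fix x assume "x \<in> closure diag_union"
  then obtain X where X: "\<And>i. X i \<in> diag_union" "X \<longlonglongrightarrow> x"
    unfolding closure_sequential by blast
  have lim: "(\<lambda>i. tr (star (X i) * X i)) \<longlonglongrightarrow> tr (star x * x)"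
    by (intro tr_tendsto diag_union_mult diag_union_star X tendsto_mult
        bounded_linear.tendsto[OF bounded_linear_star])
  have cl: "closed (\<real> \<inter> {z. Re z \<ge> 0})"
    by (intro closed_Int closed_complex_Reals closed_halfspace_Re_ge)
  have pos: "tr (star x * x) \<in> \<real> \<inter> {z. Re z \<ge> 0}"
    by (rule closed_sequentially[OF cl _ lim]) (use tr_positive_diag_union[OF X(1)] in simp)
  show "tr (star x * x) \<in> \<real>" "0 \<le> Re (tr (star x * x))" using pos by auto
  fix y assume "y \<in> closure diag_union"
  then obtain Y where Y: "\<And>i. Y i \<in> diag_union" "Y \<longlonglongrightarrow> y"
    unfolding closure_sequential by blast
  have "(\<lambda>i. tr (X i * Y i)) \<longlonglongrightarrow> tr (x * y)" "(\<lambda>i. tr (Y i * X i)) \<longlonglongrightarrow> tr (y * x)"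
    by (intro tr_tendsto diag_union_mult X Y tendsto_mult)+
  moreover have "tr (X i * Y i) = tr (Y i * X i)" for i
    using diag_union_common[OF X(1) Y(1), of i i] tr_commute_diag by metis
  ultimately show "tr (x * y) = tr (y * x)" using LIMSEQ_unique by auto
qed

section \<open>Values forced on every normalised trace\<close>

text \<open>The matrix unit argument: inserting \<open>star z * z\<close> between u and
  \<open>star v\<close> and moving the second factor to the front gives 0 or the trace of
  \<open>z * star z\<close>. So all diagonal units have the same trace, and together they sum to
  \<open>1\<close>.\<close>

lemma normalized_trace_diag:
  assumes \<tau>: "normalized_trace_on (closure diag_union) \<tau>"
    and x: "x \<in> W (k, k)" and y: "y \<in> W (k, k)"
  shows "\<tau> (x * star y) = (if x = y then 1 / of_nat (card (W (k, k))) else 0)"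
proof -
  have lin: "clinear_on (closure diag_union) \<tau>" and "\<tau> 1 = 1"
    and comm: "\<And>x y. \<lbrakk>x \<in> closure diag_union; y \<in> closure diag_union\<rbrakk> \<Longrightarrow> \<tau> (x * y) = \<tau> (y * x)"
    using \<tau> by (auto simp: normalized_trace_on_def)
  have 0: "\<tau> 0 = 0" using clinear_on_0[OF lin closure_diag_union_0] .
  have mem: "u * star v \<in> closure diag_union" if "u \<in> W (k, k)" "v \<in> W (k, k)" for u v
    using that by (intro diag_union_closure units_diag_union unitsI)
  have flip: "\<tau> (u * star v) = (if u = v then \<tau> (z * star z) else 0)"
    if "u \<in> W (k, k)" "v \<in> W (k, k)" "z \<in> W (k, k)" for u v z
    using comm[OF mem[OF that(1,3)] mem[OF that(3,2)]] that 0 by (auto simp: units_mult)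
  have "1 = \<tau> (\<Sum>w\<in>W (k, k). w * star w)"
    by (simp add: frame_sum[OF frame_W] \<open>\<tau> 1 = 1\<close>)
  also have "\<dots> = (\<Sum>w\<in>W (k, k). \<tau> (w * star w))"
    by (rule clinear_on_sum[OF lin closure_diag_union_0 closure_diag_union_add mem])
  also have "\<dots> = (\<Sum>w\<in>W (k, k). \<tau> (x * star x))"
  proof (intro sum.cong HOL.refl)
    show "\<tau> (w * star w) = \<tau> (x * star x)" if "w \<in> W (k, k)" for w
      using flip[OF that that x] by simp
  qed
  finally have "\<tau> (x * star x) = 1 / of_nat (card (W (k, k)))"
    using card_pos[of "(k, k)"] by (simp add: field_simps)
  then show ?thesis using flip[OF x y x] by auto
qed

lemma normalized_trace_units:
  assumes \<tau>: "normalized_trace_on (closure diag_union) \<tau>"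
    and x: "x \<in> W d" and y: "y \<in> W d"
  shows "\<tau> (x * star y) = (if x = y then 1 / of_nat (card (W d)) else 0)"
proof -
  obtain p q where d: "d = (p, q)" by (cases d)
  define K where "K = max p q"
  define e where "e = (K - p, K - q)"
  have de: "d + e = (K, K)" by (auto simp: d e_def K_def)
  have mem: "x * w \<in> W (K, K)" "y * w \<in> W (K, K)" if "w \<in> W e" for w
    using W_mult[OF x that] W_mult[OF y that] by (simp_all add: de)
  have lin: "clinear_on (closure diag_union) \<tau>" using \<tau> by (simp add: normalized_trace_on_def)
  have "\<tau> (x * star y) = (\<Sum>w\<in>W e. \<tau> ((x * w) * star (y * w)))"
    unfolding units_expand[of x y e]
    by (rule clinear_on_sum[OF lin closure_diag_union_0 closure_diag_union_add])
      (auto intro!: diag_union_closure units_diag_union[of _ "(K, K)"] unitsI mem)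
  also have "\<dots> = (\<Sum>w\<in>W e. if x = y then 1 / of_nat (card (W (K, K))) else 0)"
    using normalized_trace_diag[OF \<tau> mem] W_mult_eq_iff[OF x y] by (intro sum.cong HOL.refl) auto
  also have "\<dots> = (if x = y then 1 / of_nat (card (W d)) else 0)"
    using card_add[of d e] card_pos[of e] card_pos[of d] by (simp add: de)
  finally show ?thesis .
qed

text \<open>P stands for the gauge expectation. It sends \<open>core\<close> into
  \<open>diag_union\<close>, which lies where the trace is linear, so the composite is linear on
  \<open>core\<close>.\<close>

lemma trace_of_expectation:
  assumes \<tau>: "normalized_trace_on (closure diag_union) \<tau>" and P: "clinear_on core P"
    and P_units: "\<And>x y d e. \<lbrakk>x \<in> W d; y \<in> W e\<rbrakk> \<Longrightarrow> P (x * star y) = (if d = e then x * star y else 0)"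
  shows "clinear_on core (\<lambda>a. \<tau> (P a))"
    and "\<lbrakk>x \<in> W d; y \<in> W e\<rbrakk> \<Longrightarrow> \<tau> (P (x * star y)) = (if d = e \<and> x = y then 1 / of_nat (card (W d)) else 0)"
proof -
  have lin: "clinear_on (closure diag_union) \<tau>" using \<tau> by (simp add: normalized_trace_on_def)
  have mem: "P a \<in> diag_union" if "a \<in> core" for a
    using that unfolding core_def
  proof (induction rule: cspan_induct)
    case zero
    show ?case using clinear_on_0[OF P core_0] diag_union_0 by simp
  next
    case (add x y)
    then show ?case using clinear_onD(1)[OF P, of x y] by (simp add: core_def diag_union_add)
  next
    case (base c x)
    then obtain d e u v where x: "x = u * star v" "u \<in> W d" "v \<in> W e" by (auto simp: units_def)
    have "P (c *\<^sub>C x) = c *\<^sub>C P x"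
      using units_core[OF unitsI[OF x(2,3)]] clinear_onD(2)[OF P] x(1) by blast
    moreover have "P x \<in> diag_union"
      using P_units[OF x(2,3)] unitsI[OF x(2,3)]
      by (cases "d = e") (auto simp: x(1) diag_union_0 intro!: units_diag_union[of _ e])
    ultimately show ?case by (simp add: diag_union_scaleC)
  qed
  then show "clinear_on core (\<lambda>a. \<tau> (P a))"
    using clinear_onD(1)[OF lin diag_union_closure diag_union_closure]
      clinear_onD(2)[OF lin diag_union_closure] clinear_onD[OF P] by (simp add: clinear_on_def)
  have "\<tau> 0 = 0" using clinear_on_0[OF lin closure_diag_union_0] .
  then show "\<lbrakk>x \<in> W d; y \<in> W e\<rbrakk> \<Longrightarrow> \<tau> (P (x * star y)) = (if d = e \<and> x = y then 1 / of_nat (card (W d)) else 0)"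
    using normalized_trace_units[OF \<tau>, of x d y] by (auto simp: P_units)
qed

text \<open>Prescribing values on spanning elements would require that all linear relations among
  them be respected. Instead D is assembled from the maps P p, which are already linear and isolate
  the degree differences p.\<close>

lemma weight_map_exists:
  fixes P :: "int \<times> int \<Rightarrow> 'a \<Rightarrow> 'a"
  assumes P: "\<And>p. clinear_on core (P p)"
    and P_units: "\<And>p x y d e. \<lbrakk>x \<in> W d; y \<in> W e\<rbrakk> \<Longrightarrow> P p (x * star y) =
      (if p = (int (fst e) - int (fst d), int (snd e) - int (snd d)) then x * star y else 0)"
  shows "\<exists>D. clinear_on core D \<and>
    (\<forall>d e. \<forall>x\<in>W d. \<forall>y\<in>W e. D (x * star y) = weight z d e *\<^sub>C (x * star y))"
proof -
  define c where "c p = nat_cpow m (z * of_int (fst p)) * nat_cpow n (z * of_int (snd p))" for p :: "int \<times> int"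
  define supp where "supp a = {p. P p a \<noteq> 0}" for a
  define D where "D a = (\<Sum>p\<in>supp a. c p *\<^sub>C P p a)" for a
  have units_supp: "supp (x * star y) \<subseteq> {(int (fst e) - int (fst d), int (snd e) - int (snd d))}"
    if "x \<in> W d" "y \<in> W e" for x y d e
    using P_units[OF that] by (auto simp: supp_def split: if_splits)
  have fin: "finite (supp a)" if "a \<in> core" for a
    using that unfolding core_def
  proof (induction rule: cspan_induct)
    case zero
    show ?case using clinear_on_0[OF P core_0] by (simp add: supp_def)
  next
    case (add x y)
    then have "supp (x + y) \<subseteq> supp x \<union> supp y"
      using clinear_onD(1)[OF P, of x y] by (auto simp: supp_def core_def)
    then show ?case using add finite_subset by blast
  next
    case (base c x)
    then obtain d e u v where x: "x = u * star v" "u \<in> W d" "v \<in> W e" by (auto simp: units_def)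
    have sub: "supp (c *\<^sub>C x) \<subseteq> supp x"
      using units_core[OF unitsI[OF x(2,3)]] clinear_onD(2)[OF P] by (auto simp: supp_def x(1))
    show ?case by (rule finite_subset[OF subset_trans[OF sub units_supp[OF x(2,3), folded x(1)]]]) simp
  qed
  \<comment> \<open>The set of nonzero components depends on a; additivity is compared over a common
    finite superset.\<close>
  have D_eq: "D a = (\<Sum>p\<in>S. c p *\<^sub>C P p a)" if "finite S" "supp a \<subseteq> S" for a S
    unfolding D_def using that by (intro sum.mono_neutral_left) (auto simp: supp_def)
  have "clinear_on core D"
    unfolding clinear_on_def
  proof (intro conjI ballI allI)
    fix x y assume xy: "x \<in> core" "y \<in> core"
    have sub: "supp (x + y) \<subseteq> supp x \<union> supp y"
      using clinear_onD(1)[OF P xy] by (auto simp: supp_def)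
    have "D (x + y) = (\<Sum>p\<in>supp x \<union> supp y. c p *\<^sub>C P p (x + y))"
      using fin xy sub by (intro D_eq) auto
    also have "\<dots> = (\<Sum>p\<in>supp x \<union> supp y. c p *\<^sub>C P p x) + (\<Sum>p\<in>supp x \<union> supp y. c p *\<^sub>C P p y)"
      by (simp add: clinear_onD(1)[OF P xy] scaleC_add_right sum.distrib)
    also have "\<dots> = D x + D y"
      using fin xy by (simp add: D_eq[of "supp x \<union> supp y"])
    finally show "D (x + y) = D x + D y" .
  next
    fix k x assume x: "x \<in> core"
    have sub: "supp (k *\<^sub>C x) \<subseteq> supp x"
      using clinear_onD(2)[OF P x] by (auto simp: supp_def)
    show "D (k *\<^sub>C x) = k *\<^sub>C D x"
      unfolding D_eq[OF fin[OF x] sub] D_eq[OF fin[OF x] subset_refl]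
      by (simp add: clinear_onD(2)[OF P x] scaleC_sum_right scaleC_scaleC mult.commute)
  qed
  moreover have "D (x * star y) = weight z d e *\<^sub>C (x * star y)" if "x \<in> W d" "y \<in> W e" for x y d e
    unfolding D_eq[OF _ units_supp[OF that], simplified] by (simp add: P_units[OF that] c_def weight_def)
  ultimately show ?thesis by blast
qed

end

section \<open>The graph algebra and its gauge action\<close>

lemma type_cstar_simps [simp]:
  "carrier type_cstar = UNIV" "x \<otimes>\<^bsub>type_cstar\<^esub> y = x * y" "\<one>\<^bsub>type_cstar\<^esub> = 1"
  "\<zero>\<^bsub>type_cstar\<^esub> = 0" "x \<oplus>\<^bsub>type_cstar\<^esub> y = x + y"
  "cscale type_cstar = scaleC" "adj type_cstar = star"
  by (simp_all add: type_cstar_def)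

lemma finsum_type_cstar: "finite I \<Longrightarrow> finsum type_cstar f I = (\<Sum>i\<in>I. f i :: 'a::cstar_algebra)"
proof (induction I rule: finite_induct)
  interpret cstar_structure "type_cstar :: 'a cstar_struct" by (rule cstar_structure_type_cstar)
  case empty
  show ?case by simp
next
  interpret cstar_structure "type_cstar :: 'a cstar_struct" by (rule cstar_structure_type_cstar)
  case (insert i I)
  then show ?case by simp
qed

lemma star_hom_type_cstar_iff:
  "star_hom type_cstar type_cstar h \<longleftrightarrow> (\<forall>x y. h (x * y) = h x * h y) \<and> (\<forall>x y. h (x + y) = h x + h y) \<and>
    h 1 = 1 \<and> (\<forall>c x. h (c *\<^sub>C x) = c *\<^sub>C h x) \<and> (\<forall>x. h (star x) = star (h x))"
  by (auto simp: star_hom_def ring_hom_def)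

section \<open>Integrals of torus characters\<close>

lemma integral_cis_unit_interval:
  "integral (cbox 0 1) (\<lambda>x. cis (2 * pi * of_int i * x)) = (if i = 0 then 1 else 0)"
proof (cases "i = 0")
  case False
  define c where "c = \<i> * complex_of_real (2 * pi * of_int i)"
  have c: "c \<noteq> 0" using False by (simp add: c_def)
  have cis: "cis (2 * pi * of_int i * x) = exp (c * of_real x)" for x
    by (simp add: cis_conv_exp c_def mult.assoc)
  have "((\<lambda>x. exp (c * of_real x)) has_integral exp (c * of_real 1) / c - exp (c * of_real 0) / c) {0..1}"
  proof (rule fundamental_theorem_of_calculus)
    show "((\<lambda>x. exp (c * of_real x) / c) has_vector_derivative exp (c * of_real x)) (at x within {0..1})" for x
      by (rule has_vector_derivative_real_field[of "\<lambda>z. exp (c * z) / c"])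
        (use c in \<open>auto intro!: derivative_eq_intros\<close>)
  qed simp
  moreover have "exp (c * of_real 1) = 1"
    using cis[of 1] cis_multiple_2pi[of "of_int i"] by simp
  ultimately show ?thesis using False by (simp add: cis integral_unique)
qed simp

lemma has_integral_torus_character:
  fixes X :: "'a::cstar_algebra"
  shows "((\<lambda>q :: real \<times> real. (cis (2 * pi * of_int i * fst q) * cis (2 * pi * of_int j * snd q)) *\<^sub>C X)
    has_integral (if i = 0 \<and> j = 0 then X else 0)) (cbox (0, 0) (1, 1))"
proof -
  let ?f = "\<lambda>q :: real \<times> real. cis (2 * pi * of_int i * fst q) * cis (2 * pi * of_int j * snd q)"
  have cont: "continuous_on (cbox (0, 0) (1, 1)) ?f"
    by (intro continuous_intros)
  have "integral (cbox (0, 0) (1, 1)) ?f =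
      integral (cbox 0 1) (\<lambda>x. integral (cbox 0 1) (\<lambda>y. ?f (x, y)))"
    by (rule integral_prod_continuous[OF cont])
  also have "\<dots> = (if i = 0 \<and> j = 0 then 1 else 0)"
    using integral_cis_unit_interval[of i] integral_cis_unit_interval[of j] by simp
  finally have "(?f has_integral (if i = 0 \<and> j = 0 then 1 else 0)) (cbox (0, 0) (1, 1))"
    using integrable_integral[OF integrable_continuous[OF cont]] by simp
  from has_integral_linear[OF this bounded_linear_scaleC_left[of X]]
  show ?thesis by (simp add: comp_def scaleC_one if_distrib[of "\<lambda>c. c *\<^sub>C X"] cong: if_cong)
qed

lemma cnj_power_mult:
  assumes "cmod a = 1" "cmod b = 1"
  shows "(cnj a ^ k * cnj b ^ l) * (a ^ k * b ^ l) = 1"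
proof -
  have "a * cnj a = 1" "b * cnj b = 1" using assms complex_norm_square[of a] complex_norm_square[of b] by simp_all
  moreover have "(cnj a ^ k * cnj b ^ l) * (a ^ k * b ^ l) = (a * cnj a) ^ k * (b * cnj b) ^ l"
    by (simp only: power_mult_distrib ac_simps)
  ultimately show ?thesis by simp
qed

section \<open>Words, congruence classes and degrees\<close>

lemma words_append: "u @ v \<in> words m n \<longleftrightarrow> u \<in> words m n \<and> v \<in> words m n"
  by (simp add: words_def)

lemma word_cong_append: "word_cong m n \<theta> u v \<Longrightarrow> word_cong m n \<theta> (a @ u @ b) (a @ v @ b)"
proof (induction rule: word_cong.induct)
  case (comm i j i' j' u v)
  then show ?case using word_cong.comm[of i m j n \<theta> i' j' "a @ u" "v @ b"] by simp
qed (auto intro: word_cong.intros)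

lemma word_degree_append: "word_degree (u @ v) = word_degree u + word_degree v"
  by (simp add: word_degree_def)

lemma word_degree_simps [simp]:
  "word_degree [] = 0" "word_degree (Egen i # w) = (1, 0) + word_degree w"
  "word_degree (Fgen j # w) = (0, 1) + word_degree w"
  by (auto simp: word_degree_def zero_prod_def)

lemma word_cong_degree: "word_cong m n \<theta> u v \<Longrightarrow> word_degree u = word_degree v"
  by (induction rule: word_cong.induct) (auto simp: word_degree_append add.left_commute)

lemma equiv_word_rel: "equiv (words m n) (word_rel m n \<theta>)"
  by (rule equivI)
    (auto simp: word_rel_def refl_on_def sym_def trans_def intro: word_cong.intros)

lemma word_rel_append:
  "\<lbrakk>(u, u') \<in> word_rel m n \<theta>; (v, v') \<in> word_rel m n \<theta>\<rbrakk> \<Longrightarrow> (u @ v, u' @ v') \<in> word_rel m n \<theta>"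
  using word_cong_append[of m n \<theta> u u' "[]" v] word_cong_append[of m n \<theta> v v' u' "[]"]
  by (auto simp: word_rel_def words_append intro: word_cong.trans)

lemma two_graph_mult:
  assumes "u \<in> words m n" "v \<in> words m n"
  shows "word_rel m n \<theta> `` {u} \<otimes>\<^bsub>two_graph m n \<theta>\<^esub> word_rel m n \<theta> `` {v} = word_rel m n \<theta> `` {u @ v}"
proof -
  let ?R = "word_rel m n \<theta>"
  have "?R `` {u' @ v'} = ?R `` {u @ v}" if "u' \<in> ?R `` {u}" "v' \<in> ?R `` {v}" for u' v'
    using that word_rel_append[of u u' m n \<theta> v v'] equiv_class_eq[OF equiv_word_rel] by fastforce
  moreover have "u \<in> ?R `` {u}" "v \<in> ?R `` {v}"
    using assms equiv_class_self[OF equiv_word_rel] by auto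
  ultimately have "(\<Union>u'\<in>?R `` {u}. \<Union>v'\<in>?R `` {v}. ?R `` {u' @ v'}) = ?R `` {u @ v}" by blast
  then show ?thesis by (simp add: two_graph_def)
qed

lemma carrier_two_graph: "carrier (two_graph m n \<theta>) = (\<lambda>w. word_rel m n \<theta> `` {w}) ` words m n"
  by (auto simp: two_graph_def quotient_def)

lemma one_two_graph: "\<one>\<^bsub>two_graph m n \<theta>\<^esub> = word_rel m n \<theta> `` {[]}"
  by (simp add: two_graph_def)

lemma degree_class: "w \<in> words m n \<Longrightarrow> degree (word_rel m n \<theta> `` {w}) = word_degree w"
proof -
  assume w: "w \<in> words m n"
  have "word_degree ` (word_rel m n \<theta> `` {w}) = {word_degree w}"
    using equiv_class_self[OF equiv_word_rel w, of \<theta>]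
    by (auto simp: word_rel_def dest: word_cong_degree)
  then show ?thesis by (simp add: degree_def)
qed

lemma graph_family_type_cstar_iff:
  fixes t :: "gen list set \<Rightarrow> 'a::cstar_algebra"
  shows "graph_family m n \<theta> type_cstar t \<longleftrightarrow>
    (\<forall>u\<in>carrier (two_graph m n \<theta>). star (t u) * t u = 1) \<and>
    t \<one>\<^bsub>two_graph m n \<theta>\<^esub> = 1 \<and>
    (\<forall>u\<in>carrier (two_graph m n \<theta>). \<forall>v\<in>carrier (two_graph m n \<theta>). t (u \<otimes>\<^bsub>two_graph m n \<theta>\<^esub> v) = t u * t v) \<and>
    (\<Sum>i\<in>{1..m}. t (e_gen m n \<theta> i) * star (t (e_gen m n \<theta> i))) = 1 \<and>
    (\<Sum>j\<in>{1..n}. t (f_gen m n \<theta> j) * star (t (f_gen m n \<theta> j))) = 1"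
  by (simp add: graph_family_def finsum_type_cstar)

section \<open>Factorisation and counting of the canonical isometries\<close>

locale two_graph_algebra =
  fixes m n :: nat and \<theta> :: "nat \<times> nat \<Rightarrow> nat \<times> nat" and s :: "gen list set \<Rightarrow> 'a::cstar_algebra"
  assumes \<theta>_bij: "bij_betw \<theta> ({1..m} \<times> {1..n}) ({1..m} \<times> {1..n})"
    and universal: "graph_cstar_algebra m n \<theta> s"
begin

abbreviation cls :: "gen list \<Rightarrow> gen list set"
  where "cls w \<equiv> word_rel m n \<theta> `` {w}"

text \<open>Indexing by words in place of classes makes induction on lists available.\<close>

definition S :: "gen list \<Rightarrow> 'a"
  where "S w = s (cls w)"

definition W :: "nat \<times> nat \<Rightarrow> 'a set"
  where "W d = S ` {w \<in> words m n. word_degree w = d}"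

lemma family: "graph_family m n \<theta> type_cstar s"
  using universal by (simp add: graph_cstar_algebra_def)

lemma S_isometry: "w \<in> words m n \<Longrightarrow> star (S w) * S w = 1"
  using family by (auto simp: graph_family_type_cstar_iff carrier_two_graph S_def)

lemma S_Nil: "S [] = 1"
  using family by (simp add: graph_family_type_cstar_iff one_two_graph S_def)

lemma S_append:
  assumes "u \<in> words m n" "v \<in> words m n"
  shows "S (u @ v) = S u * S v"
proof -
  have "s (cls u \<otimes>\<^bsub>two_graph m n \<theta>\<^esub> cls v) = s (cls u) * s (cls v)"
    using family assms unfolding graph_family_type_cstar_iff carrier_two_graph by blast
  then show ?thesis by (simp only: S_def two_graph_mult[OF assms])
qed

lemma S_sum: "(\<Sum>i\<in>{1..m}. S [Egen i] * star (S [Egen i])) = 1" "(\<Sum>j\<in>{1..n}. S [Fgen j] * star (S [Fgen j])) = 1"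
  using family by (simp_all add: graph_family_type_cstar_iff e_gen_def f_gen_def S_def)

lemma gen_words: "i \<in> {1..m} \<Longrightarrow> [Egen i] \<in> words m n" "j \<in> {1..n} \<Longrightarrow> [Fgen j] \<in> words m n"
  by (auto simp: words_def)

lemma S_cong: "\<lbrakk>u \<in> words m n; v \<in> words m n; word_cong m n \<theta> u v\<rbrakk> \<Longrightarrow> S u = S v"
  using equiv_class_eq[OF equiv_word_rel, of u v m n \<theta>] by (simp add: S_def word_rel_def)

lemma S_commute:
  assumes "i \<in> {1..m}" "j \<in> {1..n}" "\<theta> (i, j) = (i', j')"
  shows "S [Egen i] * S [Fgen j] = S [Fgen j'] * S [Egen i']"
proof -
  have "i' \<in> {1..m}" "j' \<in> {1..n}"
    using bij_betw_apply[OF \<theta>_bij, of "(i, j)"] assms by auto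
  then have "S ([Egen i] @ [Fgen j]) = S ([Fgen j'] @ [Egen i'])"
    using assms word_cong.comm[of i m j n \<theta> i' j' "[]" "[]"] by (intro S_cong) (auto simp: words_def)
  then show ?thesis
    using assms gen_words \<open>i' \<in> {1..m}\<close> \<open>j' \<in> {1..n}\<close> by (simp add: S_append del: append.simps)
qed

lemma words_cases:
  assumes "w \<in> words m n"
  obtains "w = []" | i v where "w = Egen i # v" "i \<in> {1..m}" "v \<in> words m n"
  | j v where "w = Fgen j # v" "j \<in> {1..n}" "v \<in> words m n"
  using assms unfolding words_def by (cases w) auto

lemma S_Cons:
  "\<lbrakk>i \<in> {1..m}; v \<in> words m n\<rbrakk> \<Longrightarrow> S (Egen i # v) = S [Egen i] * S v"
  "\<lbrakk>j \<in> {1..n}; v \<in> words m n\<rbrakk> \<Longrightarrow> S (Fgen j # v) = S [Fgen j] * S v"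
  using S_append[OF gen_words(1)] S_append[OF gen_words(2)] by force+

lemma W_mult: "\<lbrakk>x \<in> W d; y \<in> W e\<rbrakk> \<Longrightarrow> x * y \<in> W (d + e)"
  unfolding W_def by (auto simp: S_append[symmetric] word_degree_append words_append intro!: imageI)

lemma S_gen_W: "i \<in> {1..m} \<Longrightarrow> S [Egen i] \<in> W (1, 0)" "j \<in> {1..n} \<Longrightarrow> S [Fgen j] \<in> W (0, 1)"
  using gen_words by (auto simp: W_def intro!: imageI)

lemma S_W: "w \<in> words m n \<Longrightarrow> S w \<in> W (word_degree w)"
  by (simp add: W_def)

text \<open>If the word begins with an f, the induction hypothesis brings an e to the second place,
  and the pair f e is rewritten as e f. This reads the relations backwards and needs a preimage
  under \<theta>, hence its surjectivity.\<close>

lemma split_E: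
  "w \<in> words m n \<Longrightarrow> word_degree w = (Suc k, l) \<Longrightarrow> \<exists>i\<in>{1..m}. \<exists>x\<in>W (k, l). S w = S [Egen i] * x"
proof (induction w arbitrary: l)
  case (Cons g w)
  from Cons.prems(1) show ?case
  proof (cases rule: words_cases)
    case (2 i v)
    then have "word_degree v = (k, l)" using Cons.prems(2) by (cases "word_degree v") simp
    then show ?thesis using 2 S_W[of v] by (intro bexI[of _ i] bexI[of _ "S v"]) (auto simp: S_Cons)
  next
    case (3 j v)
    then obtain l' where l: "l = Suc l'" "word_degree v = (Suc k, l')"
      using Cons.prems(2) by (cases "word_degree v") auto
    obtain i x where x: "i \<in> {1..m}" "x \<in> W (k, l')" "S v = S [Egen i] * x"
      using Cons.IH[of l'] 3 l by auto
    have "(i, j) \<in> \<theta> ` ({1..m} \<times> {1..n})"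
      unfolding bij_betw_imp_surj_on[OF \<theta>_bij] using x(1) 3(2) by simp
    then obtain i' j' where ij: "i' \<in> {1..m}" "j' \<in> {1..n}" "\<theta> (i', j') = (i, j)"
      by (elim imageE SigmaE) (metis)
    have "S (g # w) = S [Fgen j] * S [Egen i] * x" using 3 x by (simp add: S_Cons mult.assoc)
    also have "\<dots> = S [Egen i'] * (S [Fgen j'] * x)"
      using arg_cong[OF S_commute[OF ij], of "\<lambda>z. z * x"] by (simp add: mult.assoc)
    finally show ?thesis
      using W_mult[OF S_gen_W(2)[OF ij(2)] x(2)] ij(1) l by auto
  qed simp
qed (simp add: zero_prod_def)

text \<open>The mirror image of \<open>split_E\<close>; a pair e f becomes f e by applying \<theta>
  itself.\<close>

lemma split_F:
  "w \<in> words m n \<Longrightarrow> word_degree w = (k, Suc l) \<Longrightarrow> \<exists>j\<in>{1..n}. \<exists>x\<in>W (k, l). S w = S [Fgen j] * x"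
proof (induction w arbitrary: k)
  case (Cons g w)
  from Cons.prems(1) show ?case
  proof (cases rule: words_cases)
    case (3 j v)
    then have "word_degree v = (k, l)" using Cons.prems(2) by (cases "word_degree v") simp
    then show ?thesis using 3 S_W[of v] by (intro bexI[of _ j] bexI[of _ "S v"]) (auto simp: S_Cons)
  next
    case (2 i v)
    then obtain k' where k: "k = Suc k'" "word_degree v = (k', Suc l)"
      using Cons.prems(2) by (cases "word_degree v") auto
    obtain j x where x: "j \<in> {1..n}" "x \<in> W (k', l)" "S v = S [Fgen j] * x"
      using Cons.IH[of k'] 2 k by auto
    obtain i' j' where ij: "\<theta> (i, j) = (i', j')" by fastforce
    then have j': "i' \<in> {1..m}" "j' \<in> {1..n}" using bij_betw_apply[OF \<theta>_bij, of "(i, j)"] x(1) 2(2) by auto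
    have "S (g # w) = S [Egen i] * S [Fgen j] * x" using 2 x by (simp add: S_Cons mult.assoc)
    also have "\<dots> = S [Fgen j'] * (S [Egen i'] * x)" using S_commute[OF 2(2) x(1) ij] by (simp add: mult.assoc)
    finally show ?thesis
      using W_mult[OF S_gen_W(1)[OF j'(1)] x(2)] j'(2) k by auto
  qed simp
qed (simp add: zero_prod_def)

lemma W_Suc:
  "W (Suc k, l) = {x * y |x y. x \<in> (\<lambda>i. S [Egen i]) ` {1..m} \<and> y \<in> W (k, l)}"
  "W (k, Suc l) = {x * y |x y. x \<in> (\<lambda>j. S [Fgen j]) ` {1..n} \<and> y \<in> W (k, l)}"
proof -
  show "W (Suc k, l) = {x * y |x y. x \<in> (\<lambda>i. S [Egen i]) ` {1..m} \<and> y \<in> W (k, l)}"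
    using split_E[of _ k l] W_mult[OF S_gen_W(1), of _ _ "(k, l)"] unfolding W_def[of "(Suc k, l)"]
    by (fastforce simp: W_def[of "(Suc k, l)", symmetric])
  show "W (k, Suc l) = {x * y |x y. x \<in> (\<lambda>j. S [Fgen j]) ` {1..n} \<and> y \<in> W (k, l)}"
    using split_F[of _ k l] W_mult[OF S_gen_W(2), of _ _ "(k, l)"] unfolding W_def[of "(k, Suc l)"]
    by (fastforce simp: W_def[of "(k, Suc l)", symmetric])
qed

lemma W_zero: "W 0 = {1}"
proof -
  have "w = []" if "w \<in> words m n" "word_degree w = 0" for w
    using that by (cases rule: words_cases) (auto simp: zero_prod_def prod_eq_iff)
  moreover have "[] \<in> words m n" by (simp add: words_def)
  ultimately have "{w \<in> words m n. word_degree w = 0} = {[]}" by auto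
  then show ?thesis by (simp add: W_def S_Nil)
qed

lemma generator_frames:
  "frame ((\<lambda>i. S [Egen i]) ` {1..m})" "card ((\<lambda>i. S [Egen i]) ` {1..m}) = m"
  "frame ((\<lambda>j. S [Fgen j]) ` {1..n})" "card ((\<lambda>j. S [Fgen j]) ` {1..n}) = n"
  using frame_isometries[of "{1..m}" "\<lambda>i. S [Egen i]"] frame_isometries[of "{1..n}" "\<lambda>j. S [Fgen j]"]
    S_sum S_isometry gen_words by (simp_all add: card_image)

text \<open>\<open>W_Suc\<close> only says that factorisations exist; \<open>frame_mult\<close> adds
  that they are unique and hence the count. The f's are built up first, and the e's are then put in
  front.\<close>

lemma frame_W: "frame (W (k, l)) \<and> card (W (k, l)) = m ^ k * n ^ l"
proof (induction k)
  case 0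
  show ?case
  proof (induction l)
    case 0
    then show ?case using W_zero by (simp add: zero_prod_def frame_one)
  next
    case (Suc l)
    then show ?case using frame_mult[OF generator_frames(3), of "W (0, l)"] generator_frames(4) by (simp add: W_Suc(2))
  qed
next
  case (Suc k)
  then show ?case using frame_mult[OF generator_frames(1), of "W (k, l)"] generator_frames(2) by (simp add: W_Suc(1))
qed

sublocale graded_frames m n W
proof
  \<comment> \<open>Without generators the sum of range projections would be empty, hence 0 and not
    1.\<close>
  show "m > 0" using S_sum(1) by (cases m) auto
  show "n > 0" using S_sum(2) by (cases n) auto
  show "frame (W d)" "card (W d) = m ^ fst d * n ^ snd d" for d
    using frame_W by (cases d; simp)+
qed (rule W_mult W_zero; assumption?)+

lemma W_eq: "W d = s ` {U \<in> carrier (two_graph m n \<theta>). degree U = d}"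
proof -
  have "{U \<in> carrier (two_graph m n \<theta>). degree U = d} = cls ` {w \<in> words m n. word_degree w = d}"
    by (auto simp: carrier_two_graph degree_class)
  then show ?thesis by (simp add: W_def S_def image_comp comp_def)
qed

lemma units_eq:
  "units d e = {s u * star (s v) |u v. u \<in> carrier (two_graph m n \<theta>) \<and> v \<in> carrier (two_graph m n \<theta>) \<and>
    degree u = d \<and> degree v = e}"
  unfolding units_def W_eq by blast

lemma core_algebra_eq: "core_algebra m n \<theta> s = core"
proof -
  have "(\<Union>d e. units d e) =
      {s u * star (s v) | u v. u \<in> carrier (two_graph m n \<theta>) \<and> v \<in> carrier (two_graph m n \<theta>)}"
    unfolding units_eq by blast
  then show ?thesis by (simp add: core_algebra_def core_def)
qed

lemma fixed_algebra_eq: "fixed_algebra m n \<theta> s = closure diag_union"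
  by (simp add: fixed_algebra_def diag_union_def diag_def units_eq)

section \<open>Gauge automorphisms\<close>

definition rotated :: "complex \<Rightarrow> complex \<Rightarrow> gen list set \<Rightarrow> 'a"
  where "rotated a b U = (a ^ fst (degree U) * b ^ snd (degree U)) *\<^sub>C s U"

lemma rotated_family:
  assumes "cmod a = 1" "cmod b = 1"
  shows "graph_family m n \<theta> type_cstar (rotated a b)"
proof -
  have rot: "star (rotated a b U) * rotated a b U = star (s U) * s U"
      "rotated a b U * star (rotated a b U) = s U * star (s U)" for U
    using cnj_power_mult[OF assms, of "fst (degree U)" "snd (degree U)"]
    by (simp_all add: rotated_def star_scaleC mult_scaleC_left mult_scaleC_right scaleC_scaleC scaleC_one mult.commute)
  have "rotated a b (cls u \<otimes>\<^bsub>two_graph m n \<theta>\<^esub> cls v) = rotated a b (cls u) * rotated a b (cls v)"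
    if "u \<in> words m n" "v \<in> words m n" for u v
    using that S_append[OF that]
    by (simp add: two_graph_mult rotated_def degree_class words_append word_degree_append S_def power_add
        mult_scaleC_left mult_scaleC_right scaleC_scaleC ac_simps)
  moreover have "rotated a b \<one>\<^bsub>two_graph m n \<theta>\<^esub> = 1"
    using S_Nil by (simp add: rotated_def one_two_graph degree_class words_def S_def scaleC_one)
  ultimately show ?thesis
    using family unfolding graph_family_type_cstar_iff rot carrier_two_graph by blast
qed

lemma universal_property:
  assumes "graph_family m n \<theta> type_cstar t"
  shows "\<exists>!h. star_hom type_cstar (type_cstar :: 'a cstar_struct) h \<and> (\<forall>w\<in>carrier (two_graph m n \<theta>). h (s w) = t w)"
proof -
  have "\<forall>(B :: 'a cstar_struct) t. cstar_structure B \<and> graph_family m n \<theta> B t \<longrightarrow>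
      (\<exists>!h. star_hom type_cstar B h \<and> (\<forall>w\<in>carrier (two_graph m n \<theta>). h (s w) = t w))"
    using universal unfolding graph_cstar_algebra_def by (elim conjE)
  from this[rule_format, OF conjI[OF cstar_structure_type_cstar assms]] show ?thesis .
qed

lemma universal_unique:
  assumes t: "graph_family m n \<theta> type_cstar t"
    and h: "star_hom type_cstar (type_cstar :: 'a cstar_struct) h" "\<And>w. w \<in> carrier (two_graph m n \<theta>) \<Longrightarrow> h (s w) = t w"
    and k: "star_hom type_cstar (type_cstar :: 'a cstar_struct) k" "\<And>w. w \<in> carrier (two_graph m n \<theta>) \<Longrightarrow> k (s w) = t w"
  shows "h = k"
  using universal_property[OF t]
proof (rule ex1E)
  fix g
  assume "\<forall>h. star_hom type_cstar type_cstar h \<and> (\<forall>w\<in>carrier (two_graph m n \<theta>). h (s w) = t w) \<longrightarrow> h = g"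
  then have "h = g" "k = g" using h k by simp_all
  then show "h = k" by simp
qed

text \<open>The inverse is the homomorphism for the conjugate point of the torus: both composites
  fix the generating isometries, so they are the identity by the uniqueness half of the universal
  property.\<close>

lemma gauge_exists:
  assumes "cmod a = 1" "cmod b = 1"
  shows "\<exists>!h. star_hom type_cstar (type_cstar :: 'a cstar_struct) h \<and> bij h \<and>
    (\<forall>w\<in>carrier (two_graph m n \<theta>). h (s w) = rotated a b w)"
proof -
  note fam = rotated_family[OF assms]
  obtain h where h: "star_hom type_cstar type_cstar h" "\<forall>w\<in>carrier (two_graph m n \<theta>). h (s w) = rotated a b w"
    using universal_property[OF fam] by (elim ex1E conjE)
  have fam': "graph_family m n \<theta> type_cstar (rotated (cnj a) (cnj b))"
    using assms by (intro rotated_family) simp_all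
  obtain g where g: "star_hom type_cstar type_cstar g"
      "\<forall>w\<in>carrier (two_graph m n \<theta>). g (s w) = rotated (cnj a) (cnj b) w"
    using universal_property[OF fam'] by (elim ex1E conjE)
  have id: "star_hom type_cstar (type_cstar :: 'a cstar_struct) (\<lambda>x. x)" by (simp add: star_hom_type_cstar_iff)
  have hg: "star_hom type_cstar type_cstar (\<lambda>x. g (h x))" "star_hom type_cstar type_cstar (\<lambda>x. h (g x))"
    using h(1) g(1) by (simp_all add: star_hom_type_cstar_iff)
  have inv: "g (h (s w)) = s w" "h (g (s w)) = s w" if "w \<in> carrier (two_graph m n \<theta>)" for w
    using h g that cnj_power_mult[OF assms, of "fst (degree w)" "snd (degree w)"]
    by (simp_all add: rotated_def star_hom_type_cstar_iff scaleC_scaleC scaleC_one mult.commute)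
  have "(\<lambda>x. g (h x)) = (\<lambda>x. x)"
    by (rule universal_unique[OF family hg(1) inv(1) id HOL.refl])
  moreover have "(\<lambda>x. h (g x)) = (\<lambda>x. x)"
    by (rule universal_unique[OF family hg(2) inv(2) id HOL.refl])
  ultimately have "bij h" by (intro o_bij[of g]) (simp_all add: fun_eq_iff)
  show ?thesis
  proof (rule ex1I[of _ h])
    show "star_hom type_cstar type_cstar h \<and> bij h \<and> (\<forall>w\<in>carrier (two_graph m n \<theta>). h (s w) = rotated a b w)"
      using h \<open>bij h\<close> by simp
    show "k = h" if "star_hom type_cstar type_cstar k \<and> bij k \<and>
        (\<forall>w\<in>carrier (two_graph m n \<theta>). k (s w) = rotated a b w)" for k
      by (rule universal_unique[OF fam]) (use that h in auto)
  qed
qed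

lemma gauge_hom:
  assumes "cmod a = 1" "cmod b = 1"
  shows "star_hom type_cstar (type_cstar :: 'a cstar_struct) (gauge m n \<theta> s (a, b))"
    and "w \<in> words m n \<Longrightarrow> gauge m n \<theta> s (a, b) (S w) = (a ^ fst (word_degree w) * b ^ snd (word_degree w)) *\<^sub>C S w"
proof -
  have "gauge m n \<theta> s (a, b) = (THE h. star_hom type_cstar type_cstar h \<and> bij h \<and>
      (\<forall>w\<in>carrier (two_graph m n \<theta>). h (s w) = rotated a b w))"
    by (simp add: gauge_def rotated_def)
  then have g: "star_hom type_cstar type_cstar (gauge m n \<theta> s (a, b))"
      "\<forall>w\<in>carrier (two_graph m n \<theta>). gauge m n \<theta> s (a, b) (s w) = rotated a b w"
    using theI'[OF gauge_exists[OF assms]] by auto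
  show "star_hom type_cstar (type_cstar :: 'a cstar_struct) (gauge m n \<theta> s (a, b))" by (rule g)
  show "gauge m n \<theta> s (a, b) (S w) = (a ^ fst (word_degree w) * b ^ snd (word_degree w)) *\<^sub>C S w"
    if "w \<in> words m n"
    using g(2) that by (simp add: carrier_two_graph S_def rotated_def degree_class)
qed

lemma gauge_units:
  assumes "x \<in> W d" "y \<in> W e"
  shows "gauge m n \<theta> s (cis \<alpha>, cis \<beta>) (x * star y) =
    (cis ((real (fst d) - real (fst e)) * \<alpha>) * cis ((real (snd d) - real (snd e)) * \<beta>)) *\<^sub>C (x * star y)"
proof -
  have val: "gauge m n \<theta> s (cis \<alpha>, cis \<beta>) x = (cis (real (fst d) * \<alpha>) * cis (real (snd d) * \<beta>)) *\<^sub>C x"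
    if "x \<in> W d" for x d
    using that gauge_hom(2)[of "cis \<alpha>" "cis \<beta>"] by (auto simp: W_def Complex.DeMoivre)
  have "gauge m n \<theta> s (cis \<alpha>, cis \<beta>) (x * star y) =
      (cis (real (fst d) * \<alpha>) * cis (real (snd d) * \<beta>) * cnj (cis (real (fst e) * \<alpha>) * cis (real (snd e) * \<beta>))) *\<^sub>C (x * star y)"
    using gauge_hom(1)[of "cis \<alpha>" "cis \<beta>"] val[OF assms(1)] val[OF assms(2)]
    by (simp add: star_hom_type_cstar_iff star_scaleC mult_scaleC_left mult_scaleC_right scaleC_scaleC ac_simps)
  then show ?thesis by (simp add: cis_cnj cis_mult algebra_simps)
qed

section \<open>Homogeneous components and the instance\<close>

text \<open>The character enters without conjugation, so index p selects the elements with d(v) -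
  d(u) = p, the very exponents of the modular power.\<close>

definition fourier :: "int \<times> int \<Rightarrow> 'a \<Rightarrow> real \<times> real \<Rightarrow> 'a"
  where "fourier p X q = (cis (2 * pi * of_int (fst p) * fst q) * cis (2 * pi * of_int (snd p) * snd q)) *\<^sub>C
    gauge m n \<theta> s (cis (2 * pi * fst q), cis (2 * pi * snd q)) X"

definition component :: "int \<times> int \<Rightarrow> 'a \<Rightarrow> 'a"
  where "component p X = integral (cbox (0, 0) (1, 1)) (fourier p X)"

lemma fourier_linear:
  "fourier p (X + Y) q = fourier p X q + fourier p Y q" "fourier p (c *\<^sub>C X) q = c *\<^sub>C fourier p X q"
  using gauge_hom(1)[of "cis (2 * pi * fst q)" "cis (2 * pi * snd q)"]
  by (simp_all add: fourier_def star_hom_type_cstar_iff scaleC_add_right scaleC_scaleC mult.commute)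

lemma fourier_units:
  assumes "x \<in> W d" "y \<in> W e"
  shows "(fourier p (x * star y) has_integral
    (if p = (int (fst e) - int (fst d), int (snd e) - int (snd d)) then x * star y else 0)) (cbox (0, 0) (1, 1))"
proof -
  let ?i = "fst p + int (fst d) - int (fst e)" and ?j = "snd p + int (snd d) - int (snd e)"
  have "fourier p (x * star y) =
      (\<lambda>q. (cis (2 * pi * of_int ?i * fst q) * cis (2 * pi * of_int ?j * snd q)) *\<^sub>C (x * star y))"
    by (rule ext) (simp add: fourier_def gauge_units[OF assms] scaleC_scaleC cis_mult algebra_simps)
  moreover have "?i = 0 \<and> ?j = 0 \<longleftrightarrow> p = (int (fst e) - int (fst d), int (snd e) - int (snd d))"
    by (auto simp: prod_eq_iff)
  ultimately show ?thesis using has_integral_torus_character[of ?i ?j "x * star y"] by simp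
qed

lemma component_units:
  "\<lbrakk>x \<in> W d; y \<in> W e\<rbrakk> \<Longrightarrow> component p (x * star y) =
    (if p = (int (fst e) - int (fst d), int (snd e) - int (snd d)) then x * star y else 0)"
  unfolding component_def by (rule integral_unique) (rule fourier_units)

text \<open>The integrand is a trigonometric polynomial with values in the algebra. Integrability is
  what makes the integral in \<open>component\<close> additive.\<close>

lemma fourier_integrable: "X \<in> core \<Longrightarrow> fourier p X integrable_on cbox (0, 0) (1, 1)"
  unfolding core_def
proof (induction rule: cspan_induct)
  case zero
  have "fourier p 0 = (\<lambda>q. 0)" using fourier_linear(2)[of p 0 0] by (simp add: fun_eq_iff)
  then show ?case by (simp add: integrable_0)
next
  case (add x y)
  have "fourier p (x + y) = (\<lambda>q. fourier p x q + fourier p y q)" by (simp add: fun_eq_iff fourier_linear)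
  then show ?case using add by (simp add: integrable_add)
next
  case (base c x)
  then obtain d e u v where x: "x = u * star v" "u \<in> W d" "v \<in> W e" by (auto simp: units_def)
  have "fourier p x integrable_on cbox (0, 0) (1, 1)"
    unfolding x(1) by (rule has_integral_integrable[OF fourier_units[OF x(2,3)]])
  then have "((*\<^sub>C) c \<circ> fourier p x) integrable_on cbox (0, 0) (1, 1)"
    by (rule integrable_linear) (rule bounded_linear_scaleC_right)
  moreover have "fourier p (c *\<^sub>C x) = (*\<^sub>C) c \<circ> fourier p x" by (simp add: fun_eq_iff fourier_linear)
  ultimately show ?case by (simp only:)
qed

lemma component_linear: "clinear_on core (component p)"
  unfolding clinear_on_def
proof (intro conjI ballI allI)
  fix x y assume "x \<in> core" "y \<in> core"
  have "fourier p (x + y) = (\<lambda>q. fourier p x q + fourier p y q)" by (simp add: fun_eq_iff fourier_linear)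
  then show "component p (x + y) = component p x + component p y"
    using fourier_integrable[OF \<open>x \<in> core\<close>] fourier_integrable[OF \<open>y \<in> core\<close>]
    by (simp add: component_def integral_add)
next
  fix c x assume "x \<in> core"
  have "fourier p (c *\<^sub>C x) = (*\<^sub>C) c \<circ> fourier p x" by (simp add: fun_eq_iff fourier_linear)
  then show "component p (c *\<^sub>C x) = c *\<^sub>C component p x"
    using integral_linear[OF fourier_integrable[OF \<open>x \<in> core\<close>] bounded_linear_scaleC_right]
    by (simp add: component_def)
qed

lemma gauge_expectation_eq: "gauge_expectation m n \<theta> s X = component (0, 0) X"
proof -
  have "fourier (0, 0) X = (\<lambda>q. gauge m n \<theta> s (cis (2 * pi * fst q), cis (2 * pi * snd q)) X)"
    by (rule ext) (simp add: fourier_def scaleC_one)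
  then show ?thesis by (simp add: gauge_expectation_def component_def)
qed

lemma fixed_trace: "normalized_trace_on (closure diag_union) (fixed_trace m n \<theta> s)"
  using someI[of "normalized_trace_on (closure diag_union)", OF normalized_trace_tr]
  by (simp add: fixed_trace_def fixed_algebra_eq)

lemma distinguished_state_linear: "clinear_on core (distinguished_state m n \<theta> s)"
  and distinguished_state_units: "\<lbrakk>x \<in> W d; y \<in> W e\<rbrakk> \<Longrightarrow>
    distinguished_state m n \<theta> s (x * star y) = (if d = e \<and> x = y then 1 / of_nat (card (W d)) else 0)"
proof -
  have P: "component (0, 0) (x * star y) = (if d = e then x * star y else 0)" if "x \<in> W d" "y \<in> W e" for x y d e
    using component_units[OF that, of "(0, 0)"] by (auto simp: prod_eq_iff)
  have eq: "distinguished_state m n \<theta> s = (\<lambda>X. fixed_trace m n \<theta> s (component (0, 0) X))"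
    by (simp add: fun_eq_iff distinguished_state_def gauge_expectation_eq)
  show "clinear_on core (distinguished_state m n \<theta> s)"
    unfolding eq by (rule trace_of_expectation(1)[OF fixed_trace component_linear P])
  show "\<lbrakk>x \<in> W d; y \<in> W e\<rbrakk> \<Longrightarrow>
      distinguished_state m n \<theta> s (x * star y) = (if d = e \<and> x = y then 1 / of_nat (card (W d)) else 0)"
    unfolding eq by (rule trace_of_expectation(2)[OF fixed_trace component_linear P])
qed

lemma modular_power_linear: "clinear_on core (modular_power m n \<theta> s z)"
  and modular_power_units:
    "\<lbrakk>x \<in> W d; y \<in> W e\<rbrakk> \<Longrightarrow> modular_power m n \<theta> s z (x * star y) = weight z d e *\<^sub>C (x * star y)"
proof -
  let ?Q = "\<lambda>D. clinear_on (core_algebra m n \<theta> s) D \<and>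
    (\<forall>u\<in>carrier (two_graph m n \<theta>). \<forall>v\<in>carrier (two_graph m n \<theta>).
      D (s u * star (s v)) =
        (nat_cpow m (z * of_int (int (fst (degree v)) - int (fst (degree u)))) *
         nat_cpow n (z * of_int (int (snd (degree v)) - int (snd (degree u))))) *\<^sub>C
        (s u * star (s v)))"
  obtain D where D: "clinear_on core D" "\<forall>d e. \<forall>x\<in>W d. \<forall>y\<in>W e. D (x * star y) = weight z d e *\<^sub>C (x * star y)"
    using weight_map_exists[where z = z, OF component_linear component_units] by blast
  have sW: "s u \<in> W (degree u)" if "u \<in> carrier (two_graph m n \<theta>)" for u
    using that unfolding W_eq by blast
  \<comment> \<open>A witness for the defining property hands that property to the map chosen by
    \<open>SOME\<close>.\<close>
  have "?Q D" using D sW by (simp add: core_algebra_eq weight_def)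
  then have "?Q (SOME D. ?Q D)" by (rule someI[of ?Q])
  then have Q: "?Q (modular_power m n \<theta> s z)" unfolding modular_power_def .
  then show "clinear_on core (modular_power m n \<theta> s z)" by (simp add: core_algebra_eq)
  show "modular_power m n \<theta> s z (x * star y) = weight z d e *\<^sub>C (x * star y)" if xy: "x \<in> W d" "y \<in> W e"
  proof -
    obtain u v where uv: "u \<in> words m n" "word_degree u = d" "x = s (cls u)"
        "v \<in> words m n" "word_degree v = e" "y = s (cls v)"
      using xy by (auto simp: W_def S_def)
    then have "cls u \<in> carrier (two_graph m n \<theta>)" "cls v \<in> carrier (two_graph m n \<theta>)"
      by (auto simp: carrier_two_graph)
    then show ?thesis using Q uv by (simp add: degree_class weight_def)
  qed
qed

sublocale modular_frames m n W "distinguished_state m n \<theta> s" "modular_power m n \<theta> s"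
  by unfold_locales
    (rule distinguished_state_linear distinguished_state_units modular_power_linear modular_power_units; assumption)+

end

theorem theorem5p3:
  fixes m n :: nat and \<theta> :: "nat \<times> nat \<Rightarrow> nat \<times> nat"
    and s :: "gen list set \<Rightarrow> 'a::cstar_algebra"
  assumes "bij_betw \<theta> ({1..m} \<times> {1..n}) ({1..m} \<times> {1..n})"
    and "graph_cstar_algebra m n \<theta> s"
  shows "modular_hilbert_algebra (core_algebra m n \<theta> s) star
    (\<lambda>A B. distinguished_state m n \<theta> s (star A * B)) (modular_power m n \<theta> s)"
proof -
  interpret two_graph_algebra m n \<theta> s using assms by unfold_locales
  show ?thesis unfolding core_algebra_eq by (rule modular_hilbert_algebra_core)
qed

end
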